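(* Let $\lambda=(\lambda_1\ge\dots\ge\lambda_n\ge 0)$, $\mu$ and $\nu=(\nu_1\ge\dots\ge\nu_n\ge0)$ be partitions with $\ell(\mu)\le n$, put $\chi_i=\nu_i-\lambda_i$ for $1\le i\le n$, and assume that all $\chi_i\ge 0$ and $\sum_{i=1}^n\chi_i=|\mu|$. Then $c^\nu_{\lambda\mu}\le K_{\mu\chi}$. Moreover, equality $c^\nu_{\lambda\mu}=K_{\mu\chi}$ holds when $\nu/\lambda$ is a horizontal strip.
   Context: $c^\nu_{\lambda\mu}$ is the (ordinary) Littlewood-Richardson coefficient, i.e. the coefficient of the Schur function $S_\nu$ in $S_\lambda S_\mu$. $K_{\mu\chi}$ is the Kostka number: the number of semistandard Young tableaux of shape $\mu$ and weight $\chi=(\chi_1,\dots,\chi_n)$, where $\chi$ is a composition (zero parts allowed). A skew shape $\nu/\lambda$ is a horizontal strip if no two of its boxes lie in the same column. *)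

theory Defs
  imports Complex_Main "HOL-Library.Poly_Mapping" "HOL-Library.FuncSet"
begin

text \<open>
  Finitely supported sequences serve as partitions (trailing zeros are thus identified),
  as weights (zero parts allowed) and as exponents of monomials.  All of them are indexed
  from 0: the first part of \<open>la\<close> is \<open>lookup la 0\<close>, the tableau entries are
  \<open>0, 1, 2, \<dots>\<close>, and an entry \<open>k\<close> contributes the variable \<open>x\<^sub>k\<close>.
\<close>

definition is_partition :: "(nat \<Rightarrow>\<^sub>0 nat) \<Rightarrow> bool" where
  "is_partition la \<longleftrightarrow> antimono (Poly_Mapping.lookup la)"

definition part_length :: "(nat \<Rightarrow>\<^sub>0 nat) \<Rightarrow> nat" where
  "part_length la = card (Poly_Mapping.keys la)"

definition part_size :: "(nat \<Rightarrow>\<^sub>0 nat) \<Rightarrow> nat" where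
  "part_size la = (\<Sum>i\<in>Poly_Mapping.keys la. Poly_Mapping.lookup la i)"

text \<open>Boxes are pairs (row, column), rows numbered from the top.\<close>

definition diagram :: "(nat \<Rightarrow>\<^sub>0 nat) \<Rightarrow> (nat \<times> nat) set" where
  "diagram la = {(i, j). j < Poly_Mapping.lookup la i}"

definition horizontal_strip :: "(nat \<Rightarrow>\<^sub>0 nat) \<Rightarrow> (nat \<Rightarrow>\<^sub>0 nat) \<Rightarrow> bool" where
  "horizontal_strip \<nu> la \<longleftrightarrow>
     diagram la \<subseteq> diagram \<nu> \<and> inj_on snd (diagram \<nu> - diagram la)"

text \<open>Fillings are extensional functions, so that each tableau is counted once.\<close>

definition ssyt :: "(nat \<Rightarrow>\<^sub>0 nat) \<Rightarrow> (nat \<times> nat \<Rightarrow> nat) set" where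
  "ssyt la = {T \<in> diagram la \<rightarrow>\<^sub>E UNIV.
     (\<forall>i j j'. j < j' \<and> (i, j') \<in> diagram la \<longrightarrow> T (i, j) \<le> T (i, j')) \<and>
     (\<forall>i i' j. i < i' \<and> (i', j) \<in> diagram la \<longrightarrow> T (i, j) < T (i', j))}"

definition has_weight ::
  "(nat \<Rightarrow>\<^sub>0 nat) \<Rightarrow> (nat \<times> nat \<Rightarrow> nat) \<Rightarrow> (nat \<Rightarrow>\<^sub>0 nat) \<Rightarrow> bool" where
  "has_weight la T \<alpha> \<longleftrightarrow> (\<forall>k. card {b \<in> diagram la. T b = k} = Poly_Mapping.lookup \<alpha> k)"

definition kostka :: "(nat \<Rightarrow>\<^sub>0 nat) \<Rightarrow> (nat \<Rightarrow>\<^sub>0 nat) \<Rightarrow> nat" where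
  "kostka \<mu> \<chi> = card {T \<in> ssyt \<mu>. has_weight \<mu> T \<chi>}"

text \<open>
  A formal power series over the integers in countably many variables is represented by
  its coefficient function on exponents.  The Schur function of \<open>la\<close> is the sum of the
  monomials \<open>x\<^sup>T\<close> over all semistandard tableaux \<open>T\<close> of shape \<open>la\<close>; collecting equal
  monomials, its coefficient at \<open>x\<^sup>\<alpha>\<close> is the number of such \<open>T\<close> of weight \<open>\<alpha>\<close>.
\<close>

type_synonym mseries = "(nat \<Rightarrow>\<^sub>0 nat) \<Rightarrow> int"

definition mseries_mult :: "mseries \<Rightarrow> mseries \<Rightarrow> mseries" where
  "mseries_mult f g = (\<lambda>\<alpha>. \<Sum>(\<beta>, \<gamma>)\<in>{(\<beta>, \<gamma>). \<beta> + \<gamma> = \<alpha>}. f \<beta> * g \<gamma>)"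

definition schur :: "(nat \<Rightarrow>\<^sub>0 nat) \<Rightarrow> mseries" where
  "schur la = (\<lambda>\<alpha>. int (card {T \<in> ssyt la. has_weight la T \<alpha>}))"

definition schur_expansion :: "mseries \<Rightarrow> ((nat \<Rightarrow>\<^sub>0 nat) \<Rightarrow> int) \<Rightarrow> bool" where
  "schur_expansion f c \<longleftrightarrow>
     finite {\<nu>. c \<nu> \<noteq> 0} \<and> (\<forall>\<nu>. c \<nu> \<noteq> 0 \<longrightarrow> is_partition \<nu>) \<and>
     f = (\<lambda>\<alpha>. \<Sum>\<nu>\<in>{\<nu>. c \<nu> \<noteq> 0}. c \<nu> * schur \<nu> \<alpha>)"

text \<open>
  The Schur functions form a basis of the ring of symmetric functions, so a product of two
  of them has exactly one expansion in the above sense.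
\<close>

definition lr_coeff ::
  "(nat \<Rightarrow>\<^sub>0 nat) \<Rightarrow> (nat \<Rightarrow>\<^sub>0 nat) \<Rightarrow> (nat \<Rightarrow>\<^sub>0 nat) \<Rightarrow> int" where
  "lr_coeff la \<mu> \<nu> = (THE c. schur_expansion (mseries_mult (schur la) (schur \<mu>)) c) \<nu>"

text \<open>The sets counted or summed over above are finite, so \<open>card\<close> and \<open>sum\<close> are meaningful.\<close>

lemma finite_diagram: "finite (diagram la)"
proof -
  have "diagram la \<subseteq> (SIGMA i:Poly_Mapping.keys la. {..<Poly_Mapping.lookup la i})"
    by (auto simp: diagram_def in_keys_iff)
  then show ?thesis
    by (rule finite_subset) auto
qed

lemma finite_ssyt_weight: "finite {T \<in> ssyt la. has_weight la T \<alpha>}"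
proof -
  have "T b \<in> Poly_Mapping.keys \<alpha>" if "b \<in> diagram la" "has_weight la T \<alpha>" for T b
  proof -
    have "b \<in> {b' \<in> diagram la. T b' = T b}"
      using that(1) by simp
    moreover have "finite {b' \<in> diagram la. T b' = T b}"
      using finite_diagram by simp
    ultimately have "card {b' \<in> diagram la. T b' = T b} > 0"
      by (metis card_gt_0_iff empty_iff)
    then show ?thesis
      using that(2) by (auto simp: has_weight_def in_keys_iff)
  qed
  then have "{T \<in> ssyt la. has_weight la T \<alpha>} \<subseteq> (diagram la \<rightarrow>\<^sub>E Poly_Mapping.keys \<alpha>)"
    unfolding ssyt_def PiE_def Pi_def by blast
  then show ?thesis
    by (rule finite_subset) (simp add: finite_PiE finite_diagram)
qed

lemma finite_add_decompositions: "finite {(\<beta>, \<gamma>). \<beta> + \<gamma> = (\<alpha> :: nat \<Rightarrow>\<^sub>0 nat)}"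
proof -
  let ?D = "{\<beta>. \<exists>\<gamma>. \<beta> + \<gamma> = \<alpha>}"
  let ?F = "{f. (\<forall>x. (x \<in> Poly_Mapping.keys \<alpha> \<longrightarrow> f x \<in> {..Max (range (Poly_Mapping.lookup \<alpha>))}) \<and>
      (x \<notin> Poly_Mapping.keys \<alpha> \<longrightarrow> f x = 0))}"
  have range: "finite (range (Poly_Mapping.lookup \<alpha>))"
  proof (rule finite_subset)
    show "range (Poly_Mapping.lookup \<alpha>) \<subseteq> insert 0 (Poly_Mapping.lookup \<alpha> ` Poly_Mapping.keys \<alpha>)"
      by (auto simp: in_keys_iff)
  qed simp
  have le: "Poly_Mapping.lookup \<beta> x \<le> Poly_Mapping.lookup \<alpha> x" if "\<beta> \<in> ?D" for \<beta> x
    using that by (auto simp: lookup_add)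
  have "finite ?F"
    by (rule finite_set_of_finite_funs) auto
  moreover have "Poly_Mapping.lookup ` ?D \<subseteq> ?F"
  proof (intro image_subsetI CollectI allI conjI impI)
    fix \<beta> x assume "\<beta> \<in> ?D"
    note le = le[OF this, of x]
    show "Poly_Mapping.lookup \<beta> x \<in> {..Max (range (Poly_Mapping.lookup \<alpha>))}"
      using le Max_ge[OF range, of "Poly_Mapping.lookup \<alpha> x"] by force
    assume "x \<notin> Poly_Mapping.keys \<alpha>"
    then show "Poly_Mapping.lookup \<beta> x = 0"
      using le by (simp add: in_keys_iff)
  qed
  ultimately have "finite (Poly_Mapping.lookup ` ?D)"
    by (rule rev_finite_subset)
  moreover have "inj_on Poly_Mapping.lookup ?D"
    by (simp add: inj_on_def)
  ultimately have D: "finite ?D"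
    by (rule finite_imageD)
  have "{(\<beta>, \<gamma>). \<beta> + \<gamma> = \<alpha>} \<subseteq> (\<lambda>\<beta>. (\<beta>, \<alpha> - \<beta>)) ` ?D"
    by (auto simp: image_iff)
  then show ?thesis
    using D by (meson finite_imageI finite_subset)
qed

end

theory Submission
  imports Defs "HOL-Combinatorics.Permutations"
begin

text \<open>
  The inequality and its equality case both fall out of one form of the Littlewood-Richardson
  rule: \<open>c\<^sup>\<nu>\<^sub>\<lambda>\<^sub>\<mu>\<close> is the number of semistandard tableaux \<open>T\<close> of shape \<open>\<mu>\<close> and weight \<open>\<nu> - \<lambda>\<close> such
  that, for every column \<open>j\<close>, adding to \<open>\<lambda>\<close> the weight of the columns \<open>\<ge> j\<close> of \<open>T\<close> gives a partition
  (\<open>lr_coeff_eq_card_lr_patterns\<close>).  The Kostka number counts the same tableaux without the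
  condition on columns, which gives the inequality.  If \<open>\<nu>/\<lambda>\<close> is a horizontal strip, then
  \<open>\<nu>\<^sub>k\<^sub>+\<^sub>1 \<le> \<lambda>\<^sub>k\<close>; as the partial sums lie between \<open>\<lambda>\<close> and \<open>\<nu>\<close>, the condition is automatic.
\<close>

text \<open>
  The rule is proved by Stembridge's argument with alternants
  \<open>a\<^sub>\<gamma> = \<Sum>\<^sub>w sgn(w) x\<^bsup>w(\<gamma>)\<^esup>\<close> in \<open>N\<close> variables.  Because Schur polynomials are symmetric,
  \<open>a\<^sub>\<lambda>\<^sub>+\<^sub>\<rho> S\<^sub>\<mu>\<close> is the sum of \<open>a\<^bsub>\<lambda>+\<rho>+wt(T)\<^esub>\<close> over all tableaux \<open>T\<close> of shape \<open>\<mu>\<close>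
  (\<open>alternant_times_schur_poly\<close>).  If \<open>T\<close> violates the condition, consider the last column at
  which it does so, the first pair \<open>k, k + 1\<close> of indices at fault there, and apply the Bender-Knuth
  involution for \<open>k, k + 1\<close> to the columns left of it.  This keeps the violation and exchanges two
  entries of \<open>\<lambda> + \<rho> + wt(T)\<close>, so the alternants of the violating tableaux cancel
  (\<open>alternant_times_schur_poly_dominant\<close>).  For \<open>\<lambda> = 0\<close> a single tableau survives and
  \<open>a\<^sub>\<rho> S\<^sub>\<mu> = a\<^sub>\<mu>\<^sub>+\<^sub>\<rho>\<close>.  Since polynomials over the integers form an integral domain, \<open>a\<^sub>\<rho>\<close> can be
  cancelled from the identity for \<open>a\<^sub>\<rho> S\<^sub>\<lambda> S\<^sub>\<mu> = a\<^sub>\<lambda>\<^sub>+\<^sub>\<rho> S\<^sub>\<mu>\<close>, which expands the product into Schur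
  polynomials (\<open>schur_poly_product\<close>).  The same bialternant formula shows that Schur expansions are
  unique, so that the coefficients found are the Littlewood-Richardson coefficients.
\<close>

text \<open>
  Tableaux are replaced throughout by Gelfand-Tsetlin patterns, which record the shape formed by
  the entries below each bound.  In this form the Bender-Knuth involution is an explicit formula in
  minima and maxima that changes one level only.
\<close>

section \<open>Partitions and Gelfand-Tsetlin patterns\<close>

lemma lookup_partition_eq_0_iff:
  assumes "is_partition \<mu>"
  shows "Poly_Mapping.lookup \<mu> i = 0 \<longleftrightarrow> part_length \<mu> \<le> i"
proof -
  let ?K = "Poly_Mapping.keys \<mu>"
  have down: "j \<in> ?K" if "j \<le> k" "k \<in> ?K" for j k
    using that assms unfolding is_partition_def in_keys_iff
    by (metis antimonoD le_zero_eq)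
  have "?K = {..<card ?K}"
  proof (rule card_subset_eq[symmetric])
    show "{..<card ?K} \<subseteq> ?K"
    proof (rule subsetI, rule ccontr)
      fix k assume k: "k \<in> {..<card ?K}" "k \<notin> ?K"
      then have "?K \<subseteq> {..<k}"
        using down by (meson lessThan_iff not_less subsetI)
      then have "card ?K \<le> k"
        by (metis card_lessThan card_mono finite_lessThan)
      then show False
        using k by simp
    qed
  qed auto
  then show ?thesis
    unfolding part_length_def by (metis in_keys_iff lessThan_iff not_less)
qed

text \<open>
  \<open>G m\<close> is the shape of the part of a tableau filled with the entries \<open>0, \<dots>, m - 1\<close>: \<open>G m i\<close> is its
  number of boxes in row \<open>i\<close>.  The two inequalities say that consecutive shapes differ by a
  horizontal strip.
\<close>

definition gt_patterns :: "(nat \<Rightarrow>\<^sub>0 nat) \<Rightarrow> (nat \<Rightarrow> nat \<Rightarrow> nat) set" where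
  "gt_patterns \<mu> = {G. G 0 = (\<lambda>_. 0) \<and>
     (\<forall>m i. G m i \<le> G (Suc m) i \<and> G (Suc m) (Suc i) \<le> G m i) \<and>
     (\<exists>N. \<forall>m\<ge>N. G m = Poly_Mapping.lookup \<mu>)}"

text \<open>
  These patterns come from the tableaux with all entries below \<open>N\<close>, that is, from the monomials of
  the Schur polynomial in \<open>N\<close> variables.
\<close>

definition gt_patterns_upto :: "nat \<Rightarrow> (nat \<Rightarrow>\<^sub>0 nat) \<Rightarrow> (nat \<Rightarrow> nat \<Rightarrow> nat) set" where
  "gt_patterns_upto N \<mu> = {G \<in> gt_patterns \<mu>. \<forall>m\<ge>N. G m = Poly_Mapping.lookup \<mu>}"

text \<open>
  This is the number of entries \<open>k\<close> in the columns \<open>\<ge> j\<close> of the tableau of \<open>G\<close>: the entries \<open>k\<close> of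
  row \<open>i\<close> occupy the columns from \<open>G k i\<close> to \<open>G (Suc k) i - 1\<close>, and the truncated subtractions
  discard the columns before \<open>j\<close>.
\<close>

definition column_weight :: "(nat \<Rightarrow>\<^sub>0 nat) \<Rightarrow> (nat \<Rightarrow> nat \<Rightarrow> nat) \<Rightarrow> nat \<Rightarrow> nat \<Rightarrow> nat" where
  "column_weight \<mu> G j k = (\<Sum>i<part_length \<mu>. (G (Suc k) i - j) - (G k i - j))"

definition gt_weight :: "(nat \<Rightarrow>\<^sub>0 nat) \<Rightarrow> (nat \<Rightarrow> nat \<Rightarrow> nat) \<Rightarrow> (nat \<Rightarrow>\<^sub>0 nat)" where
  "gt_weight \<mu> G = Poly_Mapping.Abs_poly_mapping (column_weight \<mu> G 0)"

lemma gt_patternsD: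
  assumes "G \<in> gt_patterns \<mu>"
  shows gt_level_0: "G 0 i = 0"
    and gt_Suc_ge: "G m i \<le> G (Suc m) i"
    and gt_interlace: "G (Suc m) (Suc i) \<le> G m i"
  using assms by (auto simp: gt_patterns_def)

lemma gt_level_mono:
  assumes "G \<in> gt_patterns \<mu>" "m \<le> m'"
  shows "G m i \<le> G m' i"
  using assms(2) gt_Suc_ge[OF assms(1)] by (rule lift_Suc_mono_le[of "\<lambda>m. G m i", rotated])

lemma gt_row_antimono:
  assumes "G \<in> gt_patterns \<mu>" "i \<le> i'"
  shows "G m i' \<le> G m i"
proof (rule lift_Suc_antimono_le[of "G m"])
  fix i
  have "G m (Suc i) \<le> G (Suc m) (Suc i)" "G (Suc m) (Suc i) \<le> G m i"
    using assms(1) by (auto intro: gt_Suc_ge gt_interlace)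
  then show "G m (Suc i) \<le> G m i"
    by simp
qed (rule assms(2))

lemma gt_le_shape:
  assumes "G \<in> gt_patterns \<mu>"
  shows "G m i \<le> Poly_Mapping.lookup \<mu> i"
proof -
  obtain N where "\<forall>m\<ge>N. G m = Poly_Mapping.lookup \<mu>"
    using assms by (auto simp: gt_patterns_def)
  then have "G (max m N) i = Poly_Mapping.lookup \<mu> i"
    by simp
  with gt_level_mono[OF assms, of m "max m N" i] show ?thesis
    by simp
qed

lemma gt_outside_shape:
  assumes "G \<in> gt_patterns \<mu>" "is_partition \<mu>" "part_length \<mu> \<le> i"
  shows "G m i = 0"
  using gt_le_shape[OF assms(1), of m i] assms(2,3)
  by (simp add: lookup_partition_eq_0_iff[symmetric])

lemma lookup_gt_weight:
  assumes "G \<in> gt_patterns \<mu>"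
  shows "Poly_Mapping.lookup (gt_weight \<mu> G) k = column_weight \<mu> G 0 k"
proof -
  obtain N where N: "\<forall>m\<ge>N. G m = Poly_Mapping.lookup \<mu>"
    using assms by (auto simp: gt_patterns_def)
  have "{k. column_weight \<mu> G 0 k \<noteq> 0} \<subseteq> {..<N}"
  proof (rule subsetI, rule ccontr)
    fix k assume k: "k \<in> {k. column_weight \<mu> G 0 k \<noteq> 0}" "k \<notin> {..<N}"
    then have "G k = Poly_Mapping.lookup \<mu>" "G (Suc k) = Poly_Mapping.lookup \<mu>"
      using N by auto
    then show False
      using k by (simp add: column_weight_def)
  qed
  then have "finite {k. column_weight \<mu> G 0 k \<noteq> 0}"
    by (rule finite_subset) simp
  then show ?thesis
    unfolding gt_weight_def by (simp add: Abs_poly_mapping_inverse)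
qed

text \<open>
  The truncated subtraction in a column weight hides that it is a difference of two sizes; written
  additively, it is accessible to linear arithmetic.
\<close>

lemma column_weight_eq_diff:
  assumes "G \<in> gt_patterns \<mu>"
  shows "(\<Sum>i<part_length \<mu>. G k i - j) + column_weight \<mu> G j k
    = (\<Sum>i<part_length \<mu>. G (Suc k) i - j)"
  unfolding column_weight_def sum.distrib[symmetric]
  by (intro sum.cong refl le_add_diff_inverse diff_le_mono gt_Suc_ge[OF assms])

lemma column_weight_le:
  "column_weight \<mu> G j k \<le> column_weight \<mu> G 0 k"
  unfolding column_weight_def by (intro sum_mono) auto

section \<open>Patterns and semistandard tableaux\<close>

definition pattern_of :: "(nat \<Rightarrow>\<^sub>0 nat) \<Rightarrow> (nat \<times> nat \<Rightarrow> nat) \<Rightarrow> nat \<Rightarrow> nat \<Rightarrow> nat" where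
  "pattern_of \<mu> T m i = card {c. c < Poly_Mapping.lookup \<mu> i \<and> T (i, c) < m}"

definition tableau_of :: "(nat \<Rightarrow>\<^sub>0 nat) \<Rightarrow> (nat \<Rightarrow> nat \<Rightarrow> nat) \<Rightarrow> nat \<times> nat \<Rightarrow> nat" where
  "tableau_of \<mu> G = (\<lambda>(i, c)\<in>diagram \<mu>. LEAST m. c < G (Suc m) i)"

text \<open>
  Rows of a tableau increase weakly, so that the boxes counted by \<open>pattern_of\<close> form an initial segment
  of the row.  This characterisation and the dual one for \<open>tableau_of\<close> reduce every claim about the
  correspondence to a comparison of column numbers.
\<close>

lemma less_pattern_of_iff:
  assumes "T \<in> ssyt \<mu>"
  shows "c < pattern_of \<mu> T m i \<longleftrightarrow> c < Poly_Mapping.lookup \<mu> i \<and> T (i, c) < m"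
proof -
  let ?S = "{c. c < Poly_Mapping.lookup \<mu> i \<and> T (i, c) < m}"
  have fin: "finite ?S"
    by (rule finite_subset[of _ "{..<Poly_Mapping.lookup \<mu> i}"]) auto
  have down: "c' \<in> ?S" if "c' \<le> c" "c \<in> ?S" for c' c
  proof (cases "c' = c")
    case False
    with that have "T (i, c') \<le> T (i, c)"
      using assms by (auto simp: ssyt_def diagram_def)
    then show ?thesis
      using that by auto
  qed (use that in simp)
  have "?S = {..<card ?S}"
  proof (rule card_subset_eq[symmetric, OF fin])
    show "{..<card ?S} \<subseteq> ?S"
    proof (rule subsetI, rule ccontr)
      fix k assume k: "k \<in> {..<card ?S}" "k \<notin> ?S"
      then have "?S \<subseteq> {..<k}"
        using down by (meson lessThan_iff not_less subsetI)
      then have "card ?S \<le> k"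
        by (metis card_lessThan card_mono finite_lessThan)
      then show False
        using k by simp
    qed
  qed simp
  then have "c \<in> ?S \<longleftrightarrow> c \<in> {..<card ?S}"
    by (rule arg_cong)
  then show ?thesis
    by (simp add: pattern_of_def)
qed

lemma pattern_of_in_gt_patterns:
  assumes T: "T \<in> ssyt \<mu>" and \<mu>: "is_partition \<mu>"
  shows "pattern_of \<mu> T \<in> gt_patterns \<mu>"
proof -
  note less = less_pattern_of_iff[OF T]
  have "pattern_of \<mu> T m i \<le> pattern_of \<mu> T (Suc m) i" for m i
    using less[of "pattern_of \<mu> T (Suc m) i" m i] less[of "pattern_of \<mu> T (Suc m) i" "Suc m" i]
    by (intro leI notI) auto
  moreover have "pattern_of \<mu> T (Suc m) (Suc i) \<le> pattern_of \<mu> T m i" for m i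
  proof (rule ccontr)
    let ?c = "pattern_of \<mu> T m i"
    assume "\<not> ?thesis"
    then have c: "?c < Poly_Mapping.lookup \<mu> (Suc i)" "T (Suc i, ?c) < Suc m"
      using less[of ?c "Suc m" "Suc i"] by auto
    moreover have "T (i, ?c) < T (Suc i, ?c)"
      using T c by (auto simp: ssyt_def diagram_def)
    moreover have "Poly_Mapping.lookup \<mu> (Suc i) \<le> Poly_Mapping.lookup \<mu> i"
      using \<mu> by (simp add: is_partition_def antimonoD)
    ultimately have "?c < ?c"
      unfolding less[of ?c m i] by simp
    then show False by simp
  qed
  moreover have "\<exists>N. \<forall>m\<ge>N. pattern_of \<mu> T m = Poly_Mapping.lookup \<mu>"
  proof -
    have "finite (T ` diagram \<mu>)"
      using finite_diagram by simp
    then obtain N where N: "\<forall>x\<in>T ` diagram \<mu>. x < N"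
      by (meson finite_nat_set_iff_bounded)
    have "pattern_of \<mu> T m i = Poly_Mapping.lookup \<mu> i" if "m \<ge> N" for m i
    proof -
      have "{c. c < Poly_Mapping.lookup \<mu> i \<and> T (i, c) < m} = {..<Poly_Mapping.lookup \<mu> i}"
        using N that by (fastforce simp: diagram_def)
      then show ?thesis
        by (simp add: pattern_of_def)
    qed
    then show ?thesis
      by blast
  qed
  ultimately show ?thesis
    by (auto simp: gt_patterns_def pattern_of_def fun_eq_iff)
qed

lemma tableau_of_less_iff:
  assumes G: "G \<in> gt_patterns \<mu>" and c: "c < Poly_Mapping.lookup \<mu> i"
  shows "tableau_of \<mu> G (i, c) < m \<longleftrightarrow> c < G m i"
proof -
  let ?P = "\<lambda>m. c < G (Suc m) i"
  obtain N where "\<forall>m\<ge>N. G m = Poly_Mapping.lookup \<mu>"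
    using G by (auto simp: gt_patterns_def)
  then have ex: "?P N"
    using c by simp
  have eq: "tableau_of \<mu> G (i, c) = Least ?P"
    using c by (simp add: tableau_of_def diagram_def)
  show ?thesis
  proof
    assume "tableau_of \<mu> G (i, c) < m"
    then have "Suc (Least ?P) \<le> m"
      by (simp add: eq)
    then show "c < G m i"
      using LeastI[of ?P, OF ex] gt_level_mono[OF G, of "Suc (Least ?P)" m i] by simp
  next
    assume less: "c < G m i"
    then obtain m' where m': "m = Suc m'"
      using gt_level_0[OF G] by (cases m) auto
    then have "Least ?P \<le> m'"
      using less by (intro Least_le) simp
    then show "tableau_of \<mu> G (i, c) < m"
      by (simp add: eq m')
  qed
qed

lemma tableau_of_in_ssyt:
  assumes G: "G \<in> gt_patterns \<mu>" and \<mu>: "is_partition \<mu>"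
  shows "tableau_of \<mu> G \<in> ssyt \<mu>"
proof -
  note less = tableau_of_less_iff[OF G]
  have row: "tableau_of \<mu> G (i, c) \<le> tableau_of \<mu> G (i, c')"
    if "c < c'" "c' < Poly_Mapping.lookup \<mu> i" for i c c'
    using less[of c i "Suc (tableau_of \<mu> G (i, c'))"] less[of c' i "Suc (tableau_of \<mu> G (i, c'))"] that
    by simp
  have col: "tableau_of \<mu> G (i, c) < tableau_of \<mu> G (i', c)"
    if "i < i'" "c < Poly_Mapping.lookup \<mu> i'" for i i' c
  proof -
    let ?m = "tableau_of \<mu> G (i', c)"
    have "Poly_Mapping.lookup \<mu> i' \<le> Poly_Mapping.lookup \<mu> i"
      using \<mu> that by (simp add: is_partition_def antimonoD)
    moreover have "c < G (Suc ?m) i'"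
      using less[of c i' "Suc ?m"] that by simp
    moreover have "G (Suc ?m) i' \<le> G (Suc ?m) (Suc i)"
      using that by (intro gt_row_antimono[OF G]) simp
    moreover have "G (Suc ?m) (Suc i) \<le> G ?m i"
      by (rule gt_interlace[OF G])
    ultimately show ?thesis
      using less[of c i ?m] that by simp
  qed
  have "tableau_of \<mu> G \<in> diagram \<mu> \<rightarrow>\<^sub>E UNIV"
    by (auto simp: tableau_of_def)
  with row col show ?thesis
    by (simp add: ssyt_def diagram_def)
qed

lemma bij_betw_tableau_of:
  assumes \<mu>: "is_partition \<mu>"
  shows "bij_betw (tableau_of \<mu>) (gt_patterns \<mu>) (ssyt \<mu>)"
proof (rule bij_betw_byWitness[where f' = "pattern_of \<mu>"])
  show "\<forall>G\<in>gt_patterns \<mu>. pattern_of \<mu> (tableau_of \<mu> G) = G"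
  proof (intro ballI ext)
    fix G m i assume G: "G \<in> gt_patterns \<mu>"
    have "c < pattern_of \<mu> (tableau_of \<mu> G) m i \<longleftrightarrow> c < G m i" for c
      using less_pattern_of_iff[OF tableau_of_in_ssyt[OF G \<mu>]] tableau_of_less_iff[OF G, of c i]
        gt_le_shape[OF G, of m i] by auto
    from this[of "pattern_of \<mu> (tableau_of \<mu> G) m i"] this[of "G m i"]
    show "pattern_of \<mu> (tableau_of \<mu> G) m i = G m i"
      by linarith
  qed
  show "\<forall>T\<in>ssyt \<mu>. tableau_of \<mu> (pattern_of \<mu> T) = T"
  proof
    fix T assume T: "T \<in> ssyt \<mu>"
    show "tableau_of \<mu> (pattern_of \<mu> T) = T"
    proof (rule extensionalityI)
      show "tableau_of \<mu> (pattern_of \<mu> T) \<in> extensional (diagram \<mu>)"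
        by (auto simp: tableau_of_def)
      show "T \<in> extensional (diagram \<mu>)"
        using T by (simp add: ssyt_def PiE_iff)
      fix b assume "b \<in> diagram \<mu>"
      then obtain i c where b: "b = (i, c)" "c < Poly_Mapping.lookup \<mu> i"
        by (auto simp: diagram_def)
      have "tableau_of \<mu> (pattern_of \<mu> T) (i, c) < m \<longleftrightarrow> T (i, c) < m" for m
        using tableau_of_less_iff[OF pattern_of_in_gt_patterns[OF T \<mu>] b(2)]
          less_pattern_of_iff[OF T] b(2) by simp
      from this[of "T (i, c)"] this[of "tableau_of \<mu> (pattern_of \<mu> T) (i, c)"]
      show "tableau_of \<mu> (pattern_of \<mu> T) b = T b"
        unfolding b(1) by linarith
    qed
  qed
qed (use tableau_of_in_ssyt pattern_of_in_gt_patterns \<mu> in auto)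

lemma has_weight_tableau_of:
  assumes G: "G \<in> gt_patterns \<mu>" and \<mu>: "is_partition \<mu>"
  shows "has_weight \<mu> (tableau_of \<mu> G) \<alpha> \<longleftrightarrow> gt_weight \<mu> G = \<alpha>"
proof -
  have "card {b \<in> diagram \<mu>. tableau_of \<mu> G b = k} = column_weight \<mu> G 0 k" for k
  proof -
    have "{b \<in> diagram \<mu>. tableau_of \<mu> G b = k}
      = (SIGMA i:{..<part_length \<mu>}. {G k i..<G (Suc k) i})" (is "?L = ?R")
    proof (intro set_eqI)
      fix b :: "nat \<times> nat"
      obtain i c where b: "b = (i, c)"
        by (cases b)
      have eq: "tableau_of \<mu> G (i, c) = k \<longleftrightarrow> G k i \<le> c \<and> c < G (Suc k) i"
        if "c < Poly_Mapping.lookup \<mu> i"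
        using tableau_of_less_iff[OF G that, of k] tableau_of_less_iff[OF G that, of "Suc k"]
        by linarith
      show "b \<in> ?L \<longleftrightarrow> b \<in> ?R"
      proof (cases "c < Poly_Mapping.lookup \<mu> i")
        case True
        then have "i < part_length \<mu>"
          using lookup_partition_eq_0_iff[OF \<mu>, of i] by simp
        then show ?thesis
          using True eq by (simp add: b diagram_def)
      next
        case False
        then show ?thesis
          using gt_le_shape[OF G, of "Suc k" i] by (simp add: b diagram_def)
      qed
    qed
    then show ?thesis
      by (simp add: column_weight_def)
  qed
  then show ?thesis
    unfolding has_weight_def poly_mapping_eq_iff fun_eq_iff lookup_gt_weight[OF G] by simp
qed

lemma card_ssyt_weight:
  assumes \<mu>: "is_partition \<mu>"
  shows "card {T \<in> ssyt \<mu>. has_weight \<mu> T \<alpha>} = card {G \<in> gt_patterns \<mu>. gt_weight \<mu> G = \<alpha>}"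
proof -
  have "bij_betw (tableau_of \<mu>) {G \<in> gt_patterns \<mu>. gt_weight \<mu> G = \<alpha>} {T \<in> ssyt \<mu>. has_weight \<mu> T \<alpha>}"
  proof (rule bij_betw_imageI)
    show "inj_on (tableau_of \<mu>) {G \<in> gt_patterns \<mu>. gt_weight \<mu> G = \<alpha>}"
      by (rule inj_on_subset[OF bij_betw_imp_inj_on[OF bij_betw_tableau_of[OF \<mu>]]]) auto
    show "tableau_of \<mu> ` {G \<in> gt_patterns \<mu>. gt_weight \<mu> G = \<alpha>} = {T \<in> ssyt \<mu>. has_weight \<mu> T \<alpha>}"
      unfolding bij_betw_imp_surj_on[OF bij_betw_tableau_of[OF \<mu>], symmetric]
      by (auto simp: has_weight_tableau_of[OF _ \<mu>])
  qed
  then show ?thesis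
    by (rule bij_betw_same_card[symmetric])
qed

lemma finite_gt_patterns_upto:
  assumes \<mu>: "is_partition \<mu>"
  shows "finite (gt_patterns_upto N \<mu>)"
proof (rule inj_on_finite)
  show "inj_on (tableau_of \<mu>) (gt_patterns_upto N \<mu>)"
    by (rule inj_on_subset[OF bij_betw_imp_inj_on[OF bij_betw_tableau_of[OF \<mu>]]])
      (auto simp: gt_patterns_upto_def)
  show "tableau_of \<mu> ` gt_patterns_upto N \<mu> \<subseteq> diagram \<mu> \<rightarrow>\<^sub>E {..<N}"
  proof (intro image_subsetI PiE_I)
    fix G b assume G: "G \<in> gt_patterns_upto N \<mu>" and "b \<in> diagram \<mu>"
    then obtain i c where b: "b = (i, c)" "c < Poly_Mapping.lookup \<mu> i"
      by (auto simp: diagram_def)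
    moreover have "c < G N i"
      using G b(2) by (simp add: gt_patterns_upto_def)
    ultimately show "tableau_of \<mu> G b \<in> {..<N}"
      using tableau_of_less_iff[of G \<mu> c i N] G by (simp add: gt_patterns_upto_def)
  qed (simp add: tableau_of_def)
  show "finite (diagram \<mu> \<rightarrow>\<^sub>E {..<N})"
    by (simp add: finite_PiE finite_diagram)
qed

lemma finite_gt_patterns_weight:
  assumes \<mu>: "is_partition \<mu>"
  shows "finite {G \<in> gt_patterns \<mu>. gt_weight \<mu> G = \<alpha>}"
proof (rule inj_on_finite[OF _ _ finite_ssyt_weight])
  show "inj_on (tableau_of \<mu>) {G \<in> gt_patterns \<mu>. gt_weight \<mu> G = \<alpha>}"
    by (rule inj_on_subset[OF bij_betw_imp_inj_on[OF bij_betw_tableau_of[OF \<mu>]]]) auto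
  show "tableau_of \<mu> ` {G \<in> gt_patterns \<mu>. gt_weight \<mu> G = \<alpha>} \<subseteq> {T \<in> ssyt \<mu>. has_weight \<mu> T \<alpha>}"
    using has_weight_tableau_of[OF _ \<mu>] tableau_of_in_ssyt[OF _ \<mu>] by auto
qed

text \<open>
  A level equals its predecessor as soon as the corresponding weight vanishes, so a pattern whose
  weight vanishes from \<open>N\<close> on is constant from there, with the limit \<open>\<mu>\<close> as value.
\<close>

lemma gt_patterns_upto_iff_weight:
  assumes G: "G \<in> gt_patterns \<mu>" and \<mu>: "is_partition \<mu>"
  shows "G \<in> gt_patterns_upto N \<mu> \<longleftrightarrow> (\<forall>k\<ge>N. Poly_Mapping.lookup (gt_weight \<mu> G) k = 0)"
proof
  assume "G \<in> gt_patterns_upto N \<mu>"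
  then show "\<forall>k\<ge>N. Poly_Mapping.lookup (gt_weight \<mu> G) k = 0"
    by (simp add: lookup_gt_weight[OF G] gt_patterns_upto_def column_weight_def)
next
  assume 0: "\<forall>k\<ge>N. Poly_Mapping.lookup (gt_weight \<mu> G) k = 0"
  have step: "G (Suc k) i = G k i" if "k \<ge> N" for k i
  proof (cases "i < part_length \<mu>")
    case True
    with 0 that have "G (Suc k) i - G k i = 0"
      by (simp add: lookup_gt_weight[OF G] column_weight_def)
    then show ?thesis
      using gt_Suc_ge[OF G, of k i] by simp
  next
    case False
    then show ?thesis
      using gt_outside_shape[OF G \<mu>] by simp
  qed
  have const: "G m i = G N i" if "m \<ge> N" for m i
    using that by (induction m rule: dec_induct) (simp_all add: step)
  obtain M where M: "\<forall>m\<ge>M. G m = Poly_Mapping.lookup \<mu>"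
    using G by (auto simp: gt_patterns_def)
  have "G m = Poly_Mapping.lookup \<mu>" if "m \<ge> N" for m
  proof
    fix i
    have "G m i = G N i" "G (max M N) i = G N i"
      using that by (intro const; simp)+
    moreover have "G (max M N) = Poly_Mapping.lookup \<mu>"
      using M by simp
    ultimately show "G m i = Poly_Mapping.lookup \<mu> i"
      by simp
  qed
  then have "\<forall>m\<ge>N. G m = Poly_Mapping.lookup \<mu>"
    by blast
  then show "G \<in> gt_patterns_upto N \<mu>"
    using G by (simp add: gt_patterns_upto_def)
qed

section \<open>Bender-Knuth toggles\<close>

text \<open>
  With the levels \<open>k\<close> and \<open>k + 2\<close> kept fixed, interlacing confines \<open>G (Suc k) i\<close> to the interval from
  \<open>gt_lower G k i\<close> to \<open>gt_upper G k i\<close>; there is no upper row to respect for \<open>i = 0\<close>.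
\<close>

definition gt_upper :: "(nat \<Rightarrow> nat \<Rightarrow> nat) \<Rightarrow> nat \<Rightarrow> nat \<Rightarrow> nat" where
  "gt_upper G k i = (case i of 0 \<Rightarrow> G (Suc (Suc k)) 0
     | Suc i' \<Rightarrow> min (G (Suc (Suc k)) i) (G k i'))"

definition gt_lower :: "(nat \<Rightarrow> nat \<Rightarrow> nat) \<Rightarrow> nat \<Rightarrow> nat \<Rightarrow> nat" where
  "gt_lower G k i = max (G (Suc (Suc k)) (Suc i)) (G k i)"

text \<open>
  The Bender-Knuth involution for the entries \<open>k\<close> and \<open>k + 1\<close> reflects each \<open>G (Suc k) i\<close> in the interval
  that interlacing allows.  Here it acts on the columns before \<open>j\<close> only: the interval is cut off at \<open>j\<close>,
  and rows whose entries \<open>\<le> k\<close> reach into column \<open>j\<close> are left alone.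
\<close>

definition bk_toggle :: "nat \<Rightarrow> nat \<Rightarrow> (nat \<Rightarrow> nat \<Rightarrow> nat) \<Rightarrow> nat \<Rightarrow> nat \<Rightarrow> nat" where
  "bk_toggle j k G = G(Suc k := \<lambda>i. if j < G (Suc k) i then G (Suc k) i
     else min j (gt_upper G k i) + gt_lower G k i - G (Suc k) i)"

text \<open>
  A row with an entry \<open>\<le> k\<close> in column \<open>j\<close> has an entry \<open>< k\<close> there; in other words, no entry of column
  \<open>j\<close> equals \<open>k\<close>.
\<close>

definition absent_in_column :: "(nat \<Rightarrow> nat \<Rightarrow> nat) \<Rightarrow> nat \<Rightarrow> nat \<Rightarrow> bool" where
  "absent_in_column G j k \<longleftrightarrow> (\<forall>i. j < G (Suc k) i \<longrightarrow> j < G k i)"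

lemma gt_lower_le:
  assumes "G \<in> gt_patterns \<mu>"
  shows "gt_lower G k i \<le> G (Suc k) i"
  using gt_interlace[OF assms] gt_Suc_ge[OF assms] by (simp add: gt_lower_def)

lemma gt_upper_ge:
  assumes "G \<in> gt_patterns \<mu>"
  shows "G (Suc k) i \<le> gt_upper G k i"
  using gt_interlace[OF assms] gt_Suc_ge[OF assms] by (simp add: gt_upper_def split: nat.split)

lemma bk_toggle_other_level: "m \<noteq> Suc k \<Longrightarrow> bk_toggle j k G m = G m"
  by (simp add: bk_toggle_def)

lemma bk_toggle_same_bounds:
  "gt_upper (bk_toggle j k G) k = gt_upper G k" "gt_lower (bk_toggle j k G) k = gt_lower G k"
  by (auto simp: fun_eq_iff gt_upper_def gt_lower_def bk_toggle_other_level split: nat.split)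

lemma bk_toggle_beyond:
  "j < G (Suc k) i \<Longrightarrow> bk_toggle j k G (Suc k) i = G (Suc k) i"
  by (simp add: bk_toggle_def)

lemma bk_toggle_upto:
  assumes "G \<in> gt_patterns \<mu>" "G (Suc k) i \<le> j"
  shows "bk_toggle j k G (Suc k) i + G (Suc k) i = min j (gt_upper G k i) + gt_lower G k i"
  using gt_lower_le[OF assms(1), of k i] gt_upper_ge[OF assms(1), of k i] assms(2)
  by (simp add: bk_toggle_def)

lemma bk_toggle_less_iff:
  assumes "G \<in> gt_patterns \<mu>"
  shows "j < bk_toggle j k G (Suc k) i \<longleftrightarrow> j < G (Suc k) i"
  using bk_toggle_upto[OF assms, of k i j] gt_lower_le[OF assms, of k i] bk_toggle_beyond[of j G k i]
  by (cases "j < G (Suc k) i") auto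

lemma bk_toggle_involution:
  assumes G: "G \<in> gt_patterns \<mu>"
  shows "bk_toggle j k (bk_toggle j k G) = G"
proof (intro ext)
  fix m i
  show "bk_toggle j k (bk_toggle j k G) m i = G m i"
  proof (cases "m = Suc k \<and> \<not> j < G (Suc k) i")
    case True
    have "bk_toggle j k (bk_toggle j k G) (Suc k) i
      = min j (gt_upper G k i) + gt_lower G k i - bk_toggle j k G (Suc k) i"
      using bk_toggle_less_iff[OF G, of j k i] True
      by (subst bk_toggle_def) (simp add: bk_toggle_same_bounds)
    then show ?thesis
      using bk_toggle_upto[OF G, of k i j] True by simp
  next
    case False
    then show ?thesis
      by (cases "m = Suc k") (simp_all add: bk_toggle_beyond bk_toggle_other_level)
  qed
qed

lemma bk_toggle_bounds:
  assumes G: "G \<in> gt_patterns \<mu>"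
  shows "gt_lower G k i \<le> bk_toggle j k G (Suc k) i" "bk_toggle j k G (Suc k) i \<le> gt_upper G k i"
  using bk_toggle_upto[OF G, of k i j] gt_lower_le[OF G, of k i] gt_upper_ge[OF G, of k i]
    bk_toggle_beyond[of j G k i]
  by (cases "j < G (Suc k) i"; simp)+

lemma bk_toggle_diff:
  assumes "G \<in> gt_patterns \<mu>" "j \<le> j'"
  shows "bk_toggle j k G m i - j' = G m i - j'"
proof (cases "m = Suc k")
  case True
  then show ?thesis
    using bk_toggle_less_iff[OF assms(1), of j k i] bk_toggle_beyond[of j G k i] assms(2)
    by (cases "j < G (Suc k) i") auto
qed (simp add: bk_toggle_other_level)

lemma bk_toggle_in_gt_patterns_upto:
  assumes G: "G \<in> gt_patterns_upto N \<mu>" and k: "Suc k < N"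
  shows "bk_toggle j k G \<in> gt_patterns_upto N \<mu>"
proof -
  have G': "G \<in> gt_patterns \<mu>"
    using G by (simp add: gt_patterns_upto_def)
  note bounds = bk_toggle_bounds[OF G', where k = k and j = j]
  have "bk_toggle j k G m i \<le> bk_toggle j k G (Suc m) i" for m i
  proof -
    consider "m = k" | "m = Suc k" | "m \<noteq> k" "m \<noteq> Suc k"
      by blast
    then show ?thesis
    proof cases
      case 1
      then show ?thesis
        using bounds(1)[where i = i] by (simp add: bk_toggle_other_level gt_lower_def)
    next
      case 2
      then show ?thesis
        using bounds(2)[where i = i] by (simp add: bk_toggle_other_level gt_upper_def split: nat.splits)
    next
      case 3
      then show ?thesis
        by (simp add: bk_toggle_other_level gt_Suc_ge[OF G'])
    qed
  qed
  moreover have "bk_toggle j k G (Suc m) (Suc i) \<le> bk_toggle j k G m i" for m i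
  proof -
    consider "m = k" | "m = Suc k" | "m \<noteq> k" "m \<noteq> Suc k"
      by blast
    then show ?thesis
    proof cases
      case 1
      then show ?thesis
        using bounds(2)[where i = "Suc i"] by (simp add: bk_toggle_other_level gt_upper_def)
    next
      case 2
      then show ?thesis
        using bounds(1)[where i = i] by (simp add: bk_toggle_other_level gt_lower_def)
    next
      case 3
      then show ?thesis
        by (simp add: bk_toggle_other_level gt_interlace[OF G'])
    qed
  qed
  moreover have "\<forall>m\<ge>N. bk_toggle j k G m = Poly_Mapping.lookup \<mu>"
    using G k by (auto simp: bk_toggle_other_level gt_patterns_upto_def)
  moreover have "bk_toggle j k G 0 = (\<lambda>_. 0)"
    using G' by (simp add: bk_toggle_other_level gt_patterns_def)
  ultimately show ?thesis
    unfolding gt_patterns_upto_def gt_patterns_def by blast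
qed

text \<open>
  In every row, the old and the new value, truncated at \<open>j\<close>, have the same sum as the truncated ends of
  the interval.  Minimum and maximum of the two numbers \<open>G k n\<close> and \<open>G (k + 2) (n + 1)\<close> occur as the
  upper end in row \<open>n + 1\<close> and the lower end in row \<open>n\<close>, so that summing over all rows leaves the sizes of the levels \<open>k\<close>
  and \<open>k + 2\<close>.  That \<open>k\<close> is absent in column \<open>j\<close> makes the rows that are left alone fit in: both ends of
  their interval are at least \<open>j\<close>.
\<close>

lemma bk_toggle_truncated_sum:
  assumes G: "G \<in> gt_patterns \<mu>" and \<mu>: "is_partition \<mu>" and free: "absent_in_column G j k"
  shows "(\<Sum>i<part_length \<mu>. min j (bk_toggle j k G (Suc k) i))
       + (\<Sum>i<part_length \<mu>. min j (G (Suc k) i))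
    = (\<Sum>i<part_length \<mu>. min j (G k i)) + (\<Sum>i<part_length \<mu>. min j (G (Suc (Suc k)) i))"
proof -
  have row: "min j (bk_toggle j k G (Suc k) i) + min j (G (Suc k) i)
    = min j (gt_upper G k i) + min j (gt_lower G k i)" for i
  proof (cases "j < G (Suc k) i")
    case True
    then have "j < gt_upper G k i" "j < gt_lower G k i"
      using gt_upper_ge[OF G, of k i] free by (auto simp: absent_in_column_def gt_lower_def less_max_iff_disj)
    then show ?thesis
      using True by (simp add: bk_toggle_beyond)
  next
    case False
    then show ?thesis
      using bk_toggle_upto[OF G, of k i j] bk_toggle_less_iff[OF G, of j k i] gt_lower_le[OF G, of k i]
      by simp
  qed
  have telescope: "(\<Sum>i<n. min j (gt_upper G k i) + min j (gt_lower G k i)) + min j (gt_upper G k n)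
    = (\<Sum>i<n. min j (G k i) + min j (G (Suc (Suc k)) i)) + min j (G (Suc (Suc k)) n)" for n
  proof (induction n)
    case 0
    show ?case
      by (simp add: gt_upper_def)
  next
    case (Suc n)
    have "min j (gt_lower G k n) + min j (gt_upper G k (Suc n))
      = min j (G k n) + min j (G (Suc (Suc k)) (Suc n))"
      by (auto simp: gt_lower_def gt_upper_def min_def max_def)
    then show ?case
      using Suc by simp
  qed
  have "G (Suc (Suc k)) (part_length \<mu>) = 0"
    using gt_outside_shape[OF G \<mu>] by simp
  then have "gt_upper G k (part_length \<mu>) = 0"
    by (cases "part_length \<mu>") (simp_all add: gt_upper_def)
  then show ?thesis
    using telescope[of "part_length \<mu>"] \<open>G (Suc (Suc k)) (part_length \<mu>) = 0\<close>
    unfolding sum.distrib[symmetric] row by simp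
qed

lemma column_weight_bk_toggle:
  assumes "G \<in> gt_patterns \<mu>" "j \<le> j'"
  shows "column_weight \<mu> (bk_toggle j k G) j' m = column_weight \<mu> G j' m"
  by (simp add: column_weight_def bk_toggle_diff[OF assms])

text \<open>
  The toggle exchanges the numbers of entries \<open>k\<close> and \<open>k + 1\<close> in the columns before \<open>j\<close>.  These numbers
  are differences of a weight and a column weight, and the equations are stated without subtraction.
\<close>

lemma weight_bk_toggle:
  assumes G: "G \<in> gt_patterns_upto N \<mu>" and k: "Suc k < N"
    and \<mu>: "is_partition \<mu>" and free: "absent_in_column G j k"
  shows "column_weight \<mu> (bk_toggle j k G) 0 k + column_weight \<mu> G j (Suc k)
      = column_weight \<mu> G 0 (Suc k) + column_weight \<mu> G j k" (is ?A)
    and "column_weight \<mu> (bk_toggle j k G) 0 (Suc k) + column_weight \<mu> G j k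
      = column_weight \<mu> G 0 k + column_weight \<mu> G j (Suc k)" (is ?B)
    and "m \<noteq> k \<Longrightarrow> m \<noteq> Suc k \<Longrightarrow> column_weight \<mu> (bk_toggle j k G) 0 m = column_weight \<mu> G 0 m"
proof -
  have G': "G \<in> gt_patterns \<mu>"
    using G by (simp add: gt_patterns_upto_def)
  have B': "bk_toggle j k G \<in> gt_patterns \<mu>"
    using bk_toggle_in_gt_patterns_upto[OF G k] by (simp add: gt_patterns_upto_def)
  define Y where "Y = (\<lambda>m. \<Sum>i<part_length \<mu>. G m i - j)"
  define Z where "Z = (\<lambda>(H :: nat \<Rightarrow> nat \<Rightarrow> nat) m. \<Sum>i<part_length \<mu>. min j (H m i))"
  have Y': "Y m = (\<Sum>i<part_length \<mu>. bk_toggle j k G m i - j)" for m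
    by (simp add: Y_def bk_toggle_diff[OF G' order_refl])
  have min_plus: "x = min j x + (x - j)" for x
    by simp
  have split: "(\<Sum>i<part_length \<mu>. G m i) = Z G m + Y m" for m
    unfolding Z_def Y_def sum.distrib[symmetric] by (intro sum.cong refl min_plus)
  have split': "(\<Sum>i<part_length \<mu>. bk_toggle j k G m i) = Z (bk_toggle j k G) m + Y m" for m
    unfolding Z_def Y' sum.distrib[symmetric] by (intro sum.cong refl min_plus)
  have other: "Z (bk_toggle j k G) m = Z G m" if "m \<noteq> Suc k" for m
    using that by (simp add: Z_def bk_toggle_other_level)
  have swap: "Z (bk_toggle j k G) (Suc k) + Z G (Suc k) = Z G k + Z G (Suc (Suc k))"
    unfolding Z_def by (rule bk_toggle_truncated_sum[OF G' \<mu> free])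
  have beyond: "Y m + column_weight \<mu> G j m = Y (Suc m)" for m
    unfolding Y_def by (rule column_weight_eq_diff[OF G'])
  note diffs = column_weight_eq_diff[OF G', of k 0] column_weight_eq_diff[OF G', of "Suc k" 0]
    beyond[of k] beyond[of "Suc k"]
    column_weight_eq_diff[OF B', of k 0] column_weight_eq_diff[OF B', of "Suc k" 0]
  show ?A ?B
    using diffs swap other[of k] other[of "Suc (Suc k)"]
    by (simp_all add: split split')
  show "column_weight \<mu> (bk_toggle j k G) 0 m = column_weight \<mu> G 0 m" if "m \<noteq> k" "m \<noteq> Suc k"
    using that by (simp add: column_weight_def bk_toggle_other_level)
qed

section \<open>Symmetry of the weights\<close>

lemma lookup_map_key_perm:
  assumes "w permutes S"
  shows "Poly_Mapping.lookup (Poly_Mapping.map_key w p) i = Poly_Mapping.lookup p (w i)"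
  by (simp add: map_key.rep_eq permutes_inj[OF assms])

text \<open>
  Cut off behind the last column, the toggle is the full Bender-Knuth involution.
\<close>

lemma gt_weight_symmetric_adjacent:
  assumes \<mu>: "is_partition \<mu>" and k: "Suc k < N"
  shows "\<exists>h. bij_betw h (gt_patterns_upto N \<mu>) (gt_patterns_upto N \<mu>) \<and>
    (\<forall>G\<in>gt_patterns_upto N \<mu>. gt_weight \<mu> (h G)
       = Poly_Mapping.map_key (Transposition.transpose k (Suc k)) (gt_weight \<mu> G))"
proof (intro exI conjI ballI)
  let ?j = "Poly_Mapping.lookup \<mu> 0"
  let ?h = "bk_toggle ?j k"
  show "bij_betw ?h (gt_patterns_upto N \<mu>) (gt_patterns_upto N \<mu>)"
    by (rule bij_betw_byWitness[where f' = ?h])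
      (use bk_toggle_in_gt_patterns_upto[OF _ k] bk_toggle_involution in
        \<open>auto simp: gt_patterns_upto_def\<close>)
  fix G assume G: "G \<in> gt_patterns_upto N \<mu>"
  then have G': "G \<in> gt_patterns \<mu>" and hG: "?h G \<in> gt_patterns \<mu>"
    using bk_toggle_in_gt_patterns_upto[OF G k] by (auto simp: gt_patterns_upto_def)
  have small: "G m i \<le> ?j" for m i
    using gt_le_shape[OF G', of m 0] gt_row_antimono[OF G', of 0 i m] by simp
  then have free: "absent_in_column G ?j k"
    by (simp add: absent_in_column_def not_less[symmetric])
  have zero: "column_weight \<mu> G ?j m = 0" for m
    by (simp add: column_weight_def small)
  show "gt_weight \<mu> (?h G) = Poly_Mapping.map_key (Transposition.transpose k (Suc k)) (gt_weight \<mu> G)"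
  proof (rule poly_mapping_eqI)
    fix m
    show "Poly_Mapping.lookup (gt_weight \<mu> (?h G)) m = Poly_Mapping.lookup
      (Poly_Mapping.map_key (Transposition.transpose k (Suc k)) (gt_weight \<mu> G)) m"
      using weight_bk_toggle(1,2)[OF G k \<mu> free] weight_bk_toggle(3)[OF G k \<mu> free, of m]
      by (auto simp: lookup_map_key_perm[OF permutes_swap_id[of k UNIV "Suc k"]]
          lookup_gt_weight[OF G'] lookup_gt_weight[OF hG] zero Transposition.transpose_def)
  qed
qed

text \<open>
  Adjacent transpositions generate the symmetric group: the transposition of \<open>a\<close> and \<open>a + d + 2\<close> is the
  conjugate of the one of \<open>a\<close> and \<open>a + d + 1\<close> by an adjacent transposition.
\<close>

lemma adjacent_transpositions_induct [consumes 1, case_names id comp adjacent]: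
  assumes "w permutes {..<N::nat}"
    and "P id"
    and comp: "\<And>v w. v permutes {..<N} \<Longrightarrow> w permutes {..<N} \<Longrightarrow> P v \<Longrightarrow> P w \<Longrightarrow> P (v \<circ> w)"
    and adj: "\<And>k. Suc k < N \<Longrightarrow> P (Transposition.transpose k (Suc k))"
  shows "P w"
proof -
  have swap: "P (Transposition.transpose a (Suc (a + d)))" if "Suc (a + d) < N" for a d
    using that
  proof (induction d)
    case 0
    then show ?case
      using adj by simp
  next
    case (Suc d)
    let ?t = "Transposition.transpose (Suc (a + d)) (Suc (Suc (a + d)))"
    let ?s = "Transposition.transpose a (Suc (a + d))"
    have t: "?t permutes {..<N}" and s: "?s permutes {..<N}"
      using Suc.prems by (auto intro!: permutes_swap_id)
    have eq: "Transposition.transpose a (Suc (a + Suc d)) = ?t \<circ> (?s \<circ> ?t)"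
      by (auto simp: fun_eq_iff Transposition.transpose_def)
    have "P ?t"
      using Suc.prems by (intro adj) simp
    moreover have "P ?s"
      using Suc by simp
    ultimately show ?case
      unfolding eq using t s by (intro comp permutes_compose)
  qed
  have any: "P (Transposition.transpose a b)" if "a < N" "b < N" "a \<noteq> b" for a b
  proof (cases "a < b")
    case True
    then obtain d where "b = Suc (a + d)"
      using less_imp_Suc_add by blast
    then show ?thesis
      using swap[of a d] that(2) by simp
  next
    case False
    with that(3) have "b < a"
      by simp
    then obtain d where "a = Suc (b + d)"
      using less_imp_Suc_add by blast
    then show ?thesis
      using swap[of b d] that(1) by (simp add: transpose_commute)
  qed
  show ?thesis
    using assms(1) finite_lessThan
  proof (induction rule: permutes_induct)
    case id
    show ?case by (rule assms(2))
  next
    case (swap a b p)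
    then show ?case
      by (intro comp any permutes_swap_id) auto
  qed
qed

text \<open>
  This is the symmetry of Schur polynomials, in the form of a bijection between the patterns.
\<close>

lemma gt_weight_symmetric:
  assumes "w permutes {..<N}" and \<mu>: "is_partition \<mu>"
  shows "\<exists>h. bij_betw h (gt_patterns_upto N \<mu>) (gt_patterns_upto N \<mu>) \<and>
    (\<forall>G\<in>gt_patterns_upto N \<mu>. gt_weight \<mu> (h G) = Poly_Mapping.map_key w (gt_weight \<mu> G))"
  using assms(1)
proof (induction rule: adjacent_transpositions_induct)
  case id
  show ?case
    by (intro exI[of _ "\<lambda>G. G"]) (simp add: bij_betw_def id_def map_key_id)
next
  case (comp v w)
  then obtain f h where f: "bij_betw f (gt_patterns_upto N \<mu>) (gt_patterns_upto N \<mu>)"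
      "\<forall>G\<in>gt_patterns_upto N \<mu>. gt_weight \<mu> (f G) = Poly_Mapping.map_key v (gt_weight \<mu> G)"
    and h: "bij_betw h (gt_patterns_upto N \<mu>) (gt_patterns_upto N \<mu>)"
      "\<forall>G\<in>gt_patterns_upto N \<mu>. gt_weight \<mu> (h G) = Poly_Mapping.map_key w (gt_weight \<mu> G)"
    by blast
  have "gt_weight \<mu> ((h \<circ> f) G) = Poly_Mapping.map_key (v \<circ> w) (gt_weight \<mu> G)"
    if "G \<in> gt_patterns_upto N \<mu>" for G
    using f h that bij_betw_apply[OF f(1) that] comp.hyps
    by (simp add: map_key_compose permutes_inj)
  then show ?case
    using bij_betw_trans[OF f(1) h(1)] by blast
next
  case (adjacent k)
  then show ?case
    by (rule gt_weight_symmetric_adjacent[OF \<mu>])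
qed

section \<open>Alternants and Schur polynomials\<close>

definition alternant :: "nat \<Rightarrow> (nat \<Rightarrow>\<^sub>0 nat) \<Rightarrow> ((nat \<Rightarrow>\<^sub>0 nat) \<Rightarrow>\<^sub>0 int)" where
  "alternant N \<gamma> = (\<Sum>w\<in>{w. w permutes {..<N}}. Poly_Mapping.single (Poly_Mapping.map_key w \<gamma>) (sign w))"

definition schur_poly :: "nat \<Rightarrow> (nat \<Rightarrow>\<^sub>0 nat) \<Rightarrow> ((nat \<Rightarrow>\<^sub>0 nat) \<Rightarrow>\<^sub>0 int)" where
  "schur_poly N \<mu> = (\<Sum>G\<in>gt_patterns_upto N \<mu>. Poly_Mapping.single (gt_weight \<mu> G) 1)"

definition staircase :: "nat \<Rightarrow> (nat \<Rightarrow>\<^sub>0 nat)" where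
  "staircase N = Poly_Mapping.Abs_poly_mapping (\<lambda>i. N - 1 - i)"

lemma lookup_staircase: "Poly_Mapping.lookup (staircase N) i = N - 1 - i"
proof -
  have "{i. N - 1 - i \<noteq> 0} \<subseteq> {..<N}"
    by auto
  then have "finite {i. N - 1 - i \<noteq> 0}"
    by (rule finite_subset) simp
  then show ?thesis
    by (simp add: staircase_def)
qed

lemma alternant_adjacent:
  assumes "Suc k < N"
  shows "alternant N (Poly_Mapping.map_key (Transposition.transpose k (Suc k)) \<gamma>) = - alternant N \<gamma>"
proof -
  let ?t = "Transposition.transpose k (Suc k)"
  let ?P = "{w. w permutes {..<N}}"
  have t: "?t permutes {..<N}"
    using assms by (intro permutes_swap_id) auto
  have "alternant N \<gamma> = (\<Sum>w\<in>?P. Poly_Mapping.single (Poly_Mapping.map_key (?t \<circ> w) \<gamma>) (sign (?t \<circ> w)))"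
    unfolding alternant_def by (rule setum_permutations_compose_left[OF t])
  also have "\<dots> = (\<Sum>w\<in>?P. - Poly_Mapping.single (Poly_Mapping.map_key w (Poly_Mapping.map_key ?t \<gamma>)) (sign w))"
  proof (rule sum.cong[OF refl])
    fix w assume "w \<in> ?P"
    then have w: "w permutes {..<N}"
      by simp
    then have "permutation w" "permutation ?t"
      using permutation_permutes by (blast, blast intro: permutation_swap_id)
    then have "sign (?t \<circ> w) = - sign w"
      by (simp add: sign_compose sign_swap_id)
    moreover have "Poly_Mapping.map_key w (Poly_Mapping.map_key ?t \<gamma>) = Poly_Mapping.map_key (?t \<circ> w) \<gamma>"
      using permutes_inj[OF w] permutes_inj[OF t] by (rule map_key_compose)
    ultimately show "Poly_Mapping.single (Poly_Mapping.map_key (?t \<circ> w) \<gamma>) (sign (?t \<circ> w))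
      = - Poly_Mapping.single (Poly_Mapping.map_key w (Poly_Mapping.map_key ?t \<gamma>)) (sign w)"
      by (simp add: single_uminus)
  qed
  finally show ?thesis
    by (simp add: alternant_def sum_negf)
qed

text \<open>
  In the summand of \<open>w\<close>, symmetry allows the weights of the patterns to be permuted by \<open>w\<close> as well, so
  that \<open>w\<close> acts on the whole exponent \<open>\<gamma> + wt(G)\<close>.
\<close>

lemma alternant_times_schur_poly:
  assumes \<mu>: "is_partition \<mu>"
  shows "alternant N \<gamma> * schur_poly N \<mu>
    = (\<Sum>G\<in>gt_patterns_upto N \<mu>. alternant N (\<gamma> + gt_weight \<mu> G))"
proof -
  let ?P = "{w. w permutes {..<N}}" and ?A = "gt_patterns_upto N \<mu>"
  have "alternant N \<gamma> * schur_poly N \<mu>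
    = (\<Sum>w\<in>?P. \<Sum>G\<in>?A. Poly_Mapping.single (Poly_Mapping.map_key w \<gamma> + gt_weight \<mu> G) (sign w))"
    unfolding alternant_def schur_poly_def sum_product mult_single by simp
  also have "\<dots> = (\<Sum>w\<in>?P. \<Sum>G\<in>?A. Poly_Mapping.single (Poly_Mapping.map_key w (\<gamma> + gt_weight \<mu> G)) (sign w))"
  proof (rule sum.cong[OF refl])
    fix w assume "w \<in> ?P"
    then have w: "w permutes {..<N}"
      by simp
    then obtain h where h: "bij_betw h ?A ?A"
      "\<forall>G\<in>?A. gt_weight \<mu> (h G) = Poly_Mapping.map_key w (gt_weight \<mu> G)"
      using gt_weight_symmetric[OF w \<mu>] by blast
    have "(\<Sum>G\<in>?A. Poly_Mapping.single (Poly_Mapping.map_key w \<gamma> + gt_weight \<mu> G) (sign w))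
      = (\<Sum>G\<in>?A. Poly_Mapping.single (Poly_Mapping.map_key w \<gamma> + gt_weight \<mu> (h G)) (sign w))"
      by (rule sum.reindex_bij_betw[OF h(1), symmetric])
    also have "\<dots> = (\<Sum>G\<in>?A. Poly_Mapping.single (Poly_Mapping.map_key w (\<gamma> + gt_weight \<mu> G)) (sign w))"
      using h(2) by (simp add: map_key_plus permutes_inj[OF w])
    finally show "(\<Sum>G\<in>?A. Poly_Mapping.single (Poly_Mapping.map_key w \<gamma> + gt_weight \<mu> G) (sign w))
      = (\<Sum>G\<in>?A. Poly_Mapping.single (Poly_Mapping.map_key w (\<gamma> + gt_weight \<mu> G)) (sign w))" .
  qed
  also have "\<dots> = (\<Sum>G\<in>?A. alternant N (\<gamma> + gt_weight \<mu> G))"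
    unfolding alternant_def by (rule sum.swap)
  finally show ?thesis .
qed

section \<open>Cancellation of the patterns that violate dominance\<close>

text \<open>
  \<open>lr_dominant\<close> says that \<open>\<lambda>\<close> plus the weight of the columns \<open>\<ge> j\<close> is a partition for every \<open>j\<close>; a
  violation consists of a column \<open>j\<close> and an index \<open>k\<close> at which this sum increases.
\<close>

definition lr_violation ::
  "(nat \<Rightarrow>\<^sub>0 nat) \<Rightarrow> (nat \<Rightarrow>\<^sub>0 nat) \<Rightarrow> (nat \<Rightarrow> nat \<Rightarrow> nat) \<Rightarrow> nat \<Rightarrow> nat \<Rightarrow> bool" where
  "lr_violation la \<mu> G j k \<longleftrightarrow>
     Poly_Mapping.lookup la k + column_weight \<mu> G j k
     < Poly_Mapping.lookup la (Suc k) + column_weight \<mu> G j (Suc k)"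

definition lr_dominant ::
  "(nat \<Rightarrow>\<^sub>0 nat) \<Rightarrow> (nat \<Rightarrow>\<^sub>0 nat) \<Rightarrow> (nat \<Rightarrow> nat \<Rightarrow> nat) \<Rightarrow> bool" where
  "lr_dominant la \<mu> G \<longleftrightarrow> (\<forall>j k. \<not> lr_violation la \<mu> G j k)"

lemma column_weight_Suc:
  assumes "G \<in> gt_patterns \<mu>"
  shows "column_weight \<mu> G j k = column_weight \<mu> G (Suc j) k
    + card {i. i < part_length \<mu> \<and> G k i \<le> j \<and> j < G (Suc k) i}"
proof -
  have *: "(a - j) - (b - j) = (a - Suc j) - (b - Suc j) + (if b \<le> j \<and> j < a then 1 else 0)"
    if "b \<le> a" for a b :: nat
    using that by auto
  have "column_weight \<mu> G j k = column_weight \<mu> G (Suc j) k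
    + (\<Sum>i<part_length \<mu>. if G k i \<le> j \<and> j < G (Suc k) i then 1 else 0)"
    unfolding column_weight_def sum.distrib[symmetric]
    by (intro sum.cong refl * gt_Suc_ge[OF assms])
  also have "(\<Sum>i<part_length \<mu>. if G k i \<le> j \<and> j < G (Suc k) i then 1 else 0)
    = card {i. i < part_length \<mu> \<and> G k i \<le> j \<and> j < G (Suc k) i}"
    by (subst sum.inter_filter[symmetric]) simp_all
  finally show ?thesis .
qed

text \<open>
  Columns of a tableau increase strictly, so that \<open>k\<close> occurs at most once in a column.
\<close>

lemma card_column_entry_le_1:
  assumes G: "G \<in> gt_patterns \<mu>"
  shows "card {i. i < n \<and> G k i \<le> j \<and> j < G (Suc k) i} \<le> 1"
proof -
  have less: False if "i < i'" "G k i \<le> j" "j < G (Suc k) i'" for i i'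
    using gt_row_antimono[OF G, of "Suc i" i' "Suc k"] gt_interlace[OF G, of k i] that by simp
  have "i = i'" if "G k i \<le> j" "j < G (Suc k) i" "G k i' \<le> j" "j < G (Suc k) i'" for i i'
    using less[of i i'] less[of i' i] that by (metis linorder_neqE_nat)
  then show ?thesis
    unfolding One_nat_def by (subst card_le_Suc0_iff_eq) auto
qed

lemma lr_violation_bounded:
  assumes G: "G \<in> gt_patterns \<mu>" and la: "is_partition la" and viol: "lr_violation la \<mu> G j k"
  shows "j \<le> Poly_Mapping.lookup \<mu> 0"
proof (rule ccontr)
  assume "\<not> ?thesis"
  moreover have "G m i \<le> Poly_Mapping.lookup \<mu> 0" for m i
    using gt_le_shape[OF G, of m 0] gt_row_antimono[OF G, of 0 i m] by simp
  ultimately have "G m i - j = 0" for m i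
    by (metis diff_is_0_eq' le_trans nat_le_linear)
  then have "column_weight \<mu> G j m = 0" for m
    by (simp add: column_weight_def)
  moreover have "Poly_Mapping.lookup la (Suc k) \<le> Poly_Mapping.lookup la k"
    using la by (simp add: is_partition_def antimonoD)
  ultimately show False
    using viol by (simp add: lr_violation_def)
qed

text \<open>
  Passing from column \<open>j + 1\<close> to column \<open>j\<close> changes the parts \<open>k\<close> and \<open>k + 1\<close> by at most one each.  Hence a
  violation that is new in column \<open>j\<close> means that the parts were equal before, that \<open>k + 1\<close> occurs in the
  column and \<open>k\<close> does not, and that part \<open>k + 1\<close> is now larger by exactly one.  The index stays below \<open>N\<close>,
  as neither \<open>\<lambda>\<close> nor the weight has further parts.
\<close>

lemma last_violation:
  assumes G: "G \<in> gt_patterns_upto N \<mu>" and la: "is_partition la" "part_length la \<le> N"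
    and \<mu>: "is_partition \<mu>" and viol: "lr_violation la \<mu> G j k" and later: "\<not> lr_violation la \<mu> G (Suc j) k"
  shows "Suc k < N"
    and "absent_in_column G j k"
    and "Poly_Mapping.lookup la (Suc k) + column_weight \<mu> G j (Suc k)
      = Suc (Poly_Mapping.lookup la k + column_weight \<mu> G j k)"
proof -
  have G': "G \<in> gt_patterns \<mu>"
    using G by (simp add: gt_patterns_upto_def)
  let ?E = "\<lambda>m. {i. i < part_length \<mu> \<and> G m i \<le> j \<and> j < G (Suc m) i}"
  show "Suc k < N"
  proof (rule ccontr)
    assume "\<not> ?thesis"
    then have N: "N \<le> Suc k"
      by simp
    then have "Poly_Mapping.lookup la (Suc k) = 0"
      using la by (simp add: lookup_partition_eq_0_iff)
    moreover have "column_weight \<mu> G j (Suc k) = 0"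
      using G N by (simp add: gt_patterns_upto_def column_weight_def)
    ultimately show False
      using viol by (simp add: lr_violation_def)
  qed
  have *: "card (?E k) = 0 \<and> Poly_Mapping.lookup la (Suc k) + column_weight \<mu> G j (Suc k)
      = Suc (Poly_Mapping.lookup la k + column_weight \<mu> G j k)"
    using viol later card_column_entry_le_1[OF G', of "part_length \<mu>" "Suc k" j]
      column_weight_Suc[OF G', of j k] column_weight_Suc[OF G', of j "Suc k"]
    unfolding lr_violation_def by linarith
  then show "Poly_Mapping.lookup la (Suc k) + column_weight \<mu> G j (Suc k)
      = Suc (Poly_Mapping.lookup la k + column_weight \<mu> G j k)"
    by blast
  show "absent_in_column G j k"
    unfolding absent_in_column_def
  proof (intro allI impI, rule ccontr)
    fix i assume i: "j < G (Suc k) i" "\<not> j < G k i"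
    then have "i < part_length \<mu>"
      using gt_outside_shape[OF G' \<mu>, of i "Suc k"] by (cases "i < part_length \<mu>") simp_all
    then have "i \<in> ?E k"
      using i by simp
    moreover have "finite (?E k)"
      by simp
    ultimately have "card (?E k) > 0"
      unfolding card_gt_0_iff by blast
    then show False
      using * by simp
  qed
qed

text \<open>
  Both choices depend on the columns \<open>\<ge> critical_column\<close> only.  A toggle of the columns before it
  therefore does not affect them, which makes \<open>critical_toggle\<close> an involution.
\<close>

definition critical_column where
  "critical_column la \<mu> G = (GREATEST j. \<exists>k. lr_violation la \<mu> G j k)"

definition critical_entry where
  "critical_entry la \<mu> G = (LEAST k. lr_violation la \<mu> G (critical_column la \<mu> G) k)"

definition critical_toggle where
  "critical_toggle la \<mu> G = bk_toggle (critical_column la \<mu> G) (critical_entry la \<mu> G) G"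

lemma critical_violation:
  assumes G: "G \<in> gt_patterns \<mu>" and la: "is_partition la" and bad: "\<not> lr_dominant la \<mu> G"
  shows "lr_violation la \<mu> G (critical_column la \<mu> G) (critical_entry la \<mu> G)"
    and "critical_column la \<mu> G < j \<Longrightarrow> \<not> lr_violation la \<mu> G j k"
proof -
  let ?Q = "\<lambda>j. \<exists>k. lr_violation la \<mu> G j k"
  note bounded = lr_violation_bounded[OF G la]
  obtain j\<^sub>0 where ex: "?Q j\<^sub>0"
    using bad by (auto simp: lr_dominant_def)
  have "?Q (critical_column la \<mu> G)"
    unfolding critical_column_def
    by (rule GreatestI_nat[of ?Q, OF ex]) (use bounded in blast)
  then show "lr_violation la \<mu> G (critical_column la \<mu> G) (critical_entry la \<mu> G)"
    unfolding critical_entry_def by (rule LeastI_ex)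
  show "\<not> lr_violation la \<mu> G j k" if "critical_column la \<mu> G < j"
  proof
    assume "lr_violation la \<mu> G j k"
    then have "j \<le> critical_column la \<mu> G"
      unfolding critical_column_def by (intro Greatest_le_nat[of ?Q]) (use bounded in blast)+
    then show False
      using that by simp
  qed
qed

text \<open>
  At the critical violation, part \<open>k + 1\<close> exceeds part \<open>k\<close> by one, and \<open>\<rho>\<^sub>k = \<rho>\<^sub>k\<^sub>+\<^sub>1 + 1\<close>: disregarding
  the columns before the critical one, the parts \<open>k\<close> and \<open>k + 1\<close> of \<open>\<lambda> + \<rho> + wt(G)\<close> agree.  The toggle
  exchanges what the remaining columns add to them, hence it exchanges the parts themselves.
\<close>

lemma critical_toggle_properties:
  assumes G: "G \<in> gt_patterns_upto N \<mu>" and la: "is_partition la" "part_length la \<le> N"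
    and \<mu>: "is_partition \<mu>" and bad: "\<not> lr_dominant la \<mu> G"
  shows "critical_toggle la \<mu> G \<in> gt_patterns_upto N \<mu>"
    and "\<not> lr_dominant la \<mu> (critical_toggle la \<mu> G)"
    and "critical_toggle la \<mu> (critical_toggle la \<mu> G) = G"
    and "alternant N (la + staircase N + gt_weight \<mu> (critical_toggle la \<mu> G))
      = - alternant N (la + staircase N + gt_weight \<mu> G)"
proof -
  have G': "G \<in> gt_patterns \<mu>"
    using G by (simp add: gt_patterns_upto_def)
  define j k H where "j = critical_column la \<mu> G" and "k = critical_entry la \<mu> G"
    and "H = critical_toggle la \<mu> G"
  have H: "H = bk_toggle j k G"
    by (simp add: H_def j_def k_def critical_toggle_def)
  note crit = critical_violation[OF G' la(1) bad, folded j_def k_def]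
  note last = last_violation[OF G la \<mu> crit(1) crit(2)[OF lessI]]
  show HN: "critical_toggle la \<mu> G \<in> gt_patterns_upto N \<mu>"
    unfolding H_def[symmetric] H by (rule bk_toggle_in_gt_patterns_upto[OF G last(1)])
  then have H': "H \<in> gt_patterns \<mu>"
    by (simp add: H_def gt_patterns_upto_def)
  have same: "lr_violation la \<mu> H j' k' \<longleftrightarrow> lr_violation la \<mu> G j' k'" if "j \<le> j'" for j' k'
    by (simp add: lr_violation_def H column_weight_bk_toggle[OF G' that])
  show badH: "\<not> lr_dominant la \<mu> (critical_toggle la \<mu> G)"
    using same[of j k] crit(1) by (auto simp: lr_dominant_def H_def[symmetric])
  have "critical_column la \<mu> H = j"
  proof -
    have "\<exists>k. lr_violation la \<mu> H j k"
      using same[of j k] crit(1) by blast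
    moreover have "j' \<le> j" if "\<exists>k. lr_violation la \<mu> H j' k" for j'
      using that same[of j'] crit(2)[of j'] by (metis nat_le_linear not_le)
    ultimately show ?thesis
      unfolding critical_column_def by (rule Greatest_equality)
  qed
  moreover have "critical_entry la \<mu> H = k"
    using same[of j] by (simp add: critical_entry_def calculation k_def j_def)
  ultimately show "critical_toggle la \<mu> (critical_toggle la \<mu> G) = G"
    unfolding H_def[symmetric] critical_toggle_def[of la \<mu> H]
    using bk_toggle_involution[OF G'] by (simp add: H)
  let ?t = "Transposition.transpose k (Suc k)"
  have "la + staircase N + gt_weight \<mu> H = Poly_Mapping.map_key ?t (la + staircase N + gt_weight \<mu> G)"
  proof (rule poly_mapping_eqI)
    fix m
    note wt = weight_bk_toggle(1,2)[OF G last(1) \<mu> last(2), folded H]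
      weight_bk_toggle(3)[OF G last(1) \<mu> last(2), of m, folded H]
    consider "m = k" | "m = Suc k" | "m \<noteq> k" "m \<noteq> Suc k"
      by blast
    then show "Poly_Mapping.lookup (la + staircase N + gt_weight \<mu> H) m
      = Poly_Mapping.lookup (Poly_Mapping.map_key ?t (la + staircase N + gt_weight \<mu> G)) m"
      using wt last(1,3)
      by cases (auto simp: lookup_map_key_perm[OF permutes_swap_id[of k UNIV "Suc k"]] lookup_add
          lookup_gt_weight[OF G'] lookup_gt_weight[OF H'] lookup_staircase Transposition.transpose_def)
  qed
  then show "alternant N (la + staircase N + gt_weight \<mu> (critical_toggle la \<mu> G))
      = - alternant N (la + staircase N + gt_weight \<mu> G)"
    by (simp add: H_def[symmetric] alternant_adjacent[OF last(1)])
qed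

text \<open>
  A pattern fixed by the involution needs no separate treatment: the sum over the violating patterns
  equals its own negative.
\<close>

lemma alternant_times_schur_poly_dominant:
  assumes la: "is_partition la" "part_length la \<le> N" and \<mu>: "is_partition \<mu>"
  shows "alternant N (la + staircase N) * schur_poly N \<mu>
    = (\<Sum>G\<in>{G \<in> gt_patterns_upto N \<mu>. lr_dominant la \<mu> G}. alternant N (la + gt_weight \<mu> G + staircase N))"
proof -
  let ?A = "gt_patterns_upto N \<mu>" and ?f = "\<lambda>G. alternant N (la + staircase N + gt_weight \<mu> G)"
  let ?bad = "{G \<in> ?A. \<not> lr_dominant la \<mu> G}" and ?good = "{G \<in> ?A. lr_dominant la \<mu> G}"
  note props = critical_toggle_properties[OF _ la \<mu>]
  have "sum ?f ?bad = (\<Sum>G\<in>?bad. ?f (critical_toggle la \<mu> G))"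
    by (rule sum.reindex_bij_witness[of _ "critical_toggle la \<mu>" "critical_toggle la \<mu>"])
      (use props in auto)
  also have "\<dots> = - sum ?f ?bad"
    using props(4) by (simp add: sum_negf)
  finally have zero: "sum ?f ?bad = 0"
    by (simp only: equal_neg_zero)
  have "sum ?f ?A = sum ?f ?good + sum ?f ?bad"
    using finite_gt_patterns_upto[OF \<mu>, of N]
    by (subst sum.union_disjoint[symmetric]) (auto intro!: sum.cong)
  then show ?thesis
    unfolding alternant_times_schur_poly[OF \<mu>] zero by (simp add: ac_simps)
qed

section \<open>The bialternant formula\<close>

lemma lookup_alternant_partition:
  assumes "is_partition \<nu>" "part_length \<nu> \<le> N" "is_partition \<nu>'"
  shows "Poly_Mapping.lookup (alternant N (\<nu>' + staircase N)) (\<nu> + staircase N) = (if \<nu>' = \<nu> then 1 else 0)"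
proof -
  let ?P = "{w. w permutes {..<N}}"
  \<comment> \<open>Both exponents strictly decrease below \<open>N\<close>, so a permutation relating them is increasing.\<close>
  have id: "w = id" if w: "w permutes {..<N}"
    and eq: "Poly_Mapping.map_key w (\<nu>' + staircase N) = \<nu> + staircase N" for w
  proof -
    have eq': "Poly_Mapping.lookup (\<nu>' + staircase N) (w i) = Poly_Mapping.lookup (\<nu> + staircase N) i" for i
      using lookup_map_key_perm[OF w, of "\<nu>' + staircase N" i] eq by simp
    have mono: "w i < w i'" if "i < i'" "i' < N" for i i'
    proof (rule ccontr)
      assume "\<not> w i < w i'"
      then have le: "w i' \<le> w i"
        by simp
      have "Poly_Mapping.lookup \<nu>' (w i) \<le> Poly_Mapping.lookup \<nu>' (w i')"
        using assms(3) le unfolding is_partition_def by (rule antimonoD)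
      then have "Poly_Mapping.lookup (\<nu>' + staircase N) (w i) \<le> Poly_Mapping.lookup (\<nu>' + staircase N) (w i')"
        unfolding lookup_add lookup_staircase using le by (intro add_mono diff_le_mono2)
      then have "Poly_Mapping.lookup (\<nu> + staircase N) i \<le> Poly_Mapping.lookup (\<nu> + staircase N) i'"
        by (simp only: eq')
      moreover have "Poly_Mapping.lookup \<nu> i' \<le> Poly_Mapping.lookup \<nu> i"
        using assms(1) that by (simp add: is_partition_def antimonoD)
      ultimately show False
        using that by (simp add: lookup_add lookup_staircase)
    qed
    have "i \<le> w i" if "i < N" for i
      using that
    proof (induction i)
      case (Suc i)
      then show ?case
        using mono[of i "Suc i"] by simp
    qed simp
    then show ?thesis
      using permutes_natset_ge[OF w] by blast
  qed
  have "Poly_Mapping.lookup (alternant N (\<nu>' + staircase N)) (\<nu> + staircase N)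
    = (\<Sum>w\<in>?P. if Poly_Mapping.map_key w (\<nu>' + staircase N) = \<nu> + staircase N then sign w else 0)"
    by (simp add: alternant_def lookup_sum lookup_single when_def)
  also have "\<dots> = (\<Sum>w\<in>?P. if w = id then if \<nu>' = \<nu> then 1 else 0 else 0)"
  proof (rule sum.cong[OF refl])
    fix w assume "w \<in> ?P"
    then show "(if Poly_Mapping.map_key w (\<nu>' + staircase N) = \<nu> + staircase N then sign w else 0)
      = (if w = id then if \<nu>' = \<nu> then 1 else 0 else 0)"
      using id[of w] by (cases "w = id") (auto simp: id_def map_key_id)
  qed
  also have "\<dots> = (if \<nu>' = \<nu> then 1 else 0)"
    by (simp add: finite_permutations permutes_id)
  finally show ?thesis .
qed

text \<open>
  The pattern of the tableau whose row \<open>i\<close> is filled with \<open>i\<close>.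
\<close>

definition superstandard_pattern :: "(nat \<Rightarrow>\<^sub>0 nat) \<Rightarrow> nat \<Rightarrow> nat \<Rightarrow> nat" where
  "superstandard_pattern \<mu> m i = (if i < m then Poly_Mapping.lookup \<mu> i else 0)"

lemma superstandard_pattern_in_gt_patterns_upto:
  assumes \<mu>: "is_partition \<mu>" "part_length \<mu> \<le> N"
  shows "superstandard_pattern \<mu> \<in> gt_patterns_upto N \<mu>"
proof -
  have "superstandard_pattern \<mu> m = Poly_Mapping.lookup \<mu>" if "m \<ge> N" for m
    using \<mu> that lookup_partition_eq_0_iff[OF \<mu>(1)] by (auto simp: superstandard_pattern_def fun_eq_iff)
  moreover have "Poly_Mapping.lookup \<mu> (Suc i) \<le> Poly_Mapping.lookup \<mu> i" for i
    using \<mu>(1) by (simp add: is_partition_def antimonoD)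
  ultimately show ?thesis
    by (auto simp: gt_patterns_upto_def gt_patterns_def superstandard_pattern_def)
qed

lemma column_weight_superstandard:
  assumes \<mu>: "is_partition \<mu>"
  shows "column_weight \<mu> (superstandard_pattern \<mu>) j k = Poly_Mapping.lookup \<mu> k - j"
proof -
  have "column_weight \<mu> (superstandard_pattern \<mu>) j k
    = (\<Sum>i<part_length \<mu>. if i = k then Poly_Mapping.lookup \<mu> k - j else 0)"
    unfolding column_weight_def superstandard_pattern_def by (intro sum.cong) auto
  also have "\<dots> = Poly_Mapping.lookup \<mu> k - j"
    using lookup_partition_eq_0_iff[OF \<mu>, of k] by auto
  finally show ?thesis .
qed

text \<open>
  By induction on the row \<open>i\<close>, all its entries are \<open>\<le> i\<close>.  If \<open>k > i\<close> occurred in row \<open>i\<close>, from column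
  \<open>j = G k i\<close> on, then dominance would force an entry \<open>k - 1\<close> in one of the columns \<open>\<ge> j\<close>.  Level \<open>k\<close>
  reaches column \<open>j\<close> only in rows above \<open>i\<close>, where the entries are smaller than \<open>k - 1\<close>.
\<close>

lemma lr_dominant_0_unique:
  assumes G: "G \<in> gt_patterns \<mu>" and \<mu>: "is_partition \<mu>" and dom: "lr_dominant 0 \<mu> G"
  shows "G = superstandard_pattern \<mu>"
proof -
  obtain N where N: "\<forall>m\<ge>N. G m = Poly_Mapping.lookup \<mu>"
    using G by (auto simp: gt_patterns_def)
  have le: "column_weight \<mu> G j (Suc k) \<le> column_weight \<mu> G j k" for j k
    using dom by (auto simp: lr_dominant_def lr_violation_def not_less)
  have filled: "G m i = Poly_Mapping.lookup \<mu> i" if "i < m" for m i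
    using that
  proof (induction i arbitrary: m rule: less_induct)
    case (less i)
    have const: "G (Suc k) i = G k i" if ik: "i < k" for k
    proof (rule ccontr)
      assume "\<not> ?thesis"
      then have lt: "G k i < G (Suc k) i"
        using gt_Suc_ge[OF G, of k i] by simp
      then have i: "i < part_length \<mu>"
        using gt_outside_shape[OF G \<mu>, of i "Suc k"] by (cases "i < part_length \<mu>") simp_all
      obtain k' where k': "k = Suc k'" "i \<le> k'"
        using ik by (cases k) auto
      have "0 < (G (Suc k) i - G k i) - (G k i - G k i)"
        using lt by simp
      also have "\<dots> \<le> column_weight \<mu> G (G k i) k"
        unfolding column_weight_def using i by (intro member_le_sum) auto
      also have "\<dots> \<le> column_weight \<mu> G (G k i) k'"
        unfolding k' by (rule le)
      finally have "\<exists>i'<part_length \<mu>. 0 < (G k i' - G k i) - (G k' i' - G k i)"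
        unfolding column_weight_def k'(1)[symmetric] by (metis (no_types, lifting) lessThan_iff not_gr_zero sum.neutral)
      then obtain i' where "0 < (G k i' - G k i) - (G k' i' - G k i)"
        by blast
      then have i': "G k i < G k i'" "G k' i' < G k i'"
        by linarith+
      then have "i' < i"
        using gt_row_antimono[OF G, of i i' k] by (cases "i' < i") auto
      then have "G k' i' = Poly_Mapping.lookup \<mu> i'"
        using less.IH k'(2) by simp
      then show False
        using i'(2) gt_le_shape[OF G, of k i'] by simp
    qed
    have "G m' i = G m i" if "m \<le> m'" for m'
      using that by (induction m' rule: dec_induct) (use const less.prems in simp_all)
    from this[of "max m N"] have "G m i = G (max m N) i"
      by simp
    also have "\<dots> = Poly_Mapping.lookup \<mu> i"
      using N by simp
    finally show ?case .
  qed
  have empty: "G m i = 0" if "m \<le> i" for m i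
    using that
  proof (induction m arbitrary: i)
    case 0
    then show ?case
      by (simp add: gt_level_0[OF G])
  next
    case (Suc m)
    then obtain i' where "i = Suc i'" "m \<le> i'"
      by (cases i) auto
    then show ?case
      using Suc.IH[of i'] gt_interlace[OF G, of m i'] by simp
  qed
  show ?thesis
    by (intro ext) (simp add: superstandard_pattern_def filled empty)
qed

lemma alternant_staircase_times_schur_poly:
  assumes \<mu>: "is_partition \<mu>" "part_length \<mu> \<le> N"
  shows "alternant N (staircase N) * schur_poly N \<mu> = alternant N (\<mu> + staircase N)"
proof -
  note S = superstandard_pattern_in_gt_patterns_upto[OF \<mu>]
  have S': "superstandard_pattern \<mu> \<in> gt_patterns \<mu>"
    using S by (simp add: gt_patterns_upto_def)
  have "Poly_Mapping.lookup \<mu> (Suc k) \<le> Poly_Mapping.lookup \<mu> k" for k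
    using \<mu>(1) by (simp add: is_partition_def antimonoD)
  then have "lr_dominant 0 \<mu> (superstandard_pattern \<mu>)"
    by (auto simp: lr_dominant_def lr_violation_def column_weight_superstandard[OF \<mu>(1)] not_less diff_le_mono)
  then have single: "{G \<in> gt_patterns_upto N \<mu>. lr_dominant 0 \<mu> G} = {superstandard_pattern \<mu>}"
    using S lr_dominant_0_unique[OF _ \<mu>(1)] by (auto simp: gt_patterns_upto_def)
  have weight: "gt_weight \<mu> (superstandard_pattern \<mu>) = \<mu>"
    by (rule poly_mapping_eqI) (simp add: lookup_gt_weight[OF S'] column_weight_superstandard[OF \<mu>(1)])
  have "is_partition 0" "part_length 0 \<le> N"
    by (auto simp: is_partition_def part_length_def antimono_def)
  from alternant_times_schur_poly_dominant[OF this \<mu>(1)] show ?thesis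
    unfolding single by (simp add: weight)
qed

lemma alternant_staircase_nonzero: "alternant N (staircase N) \<noteq> 0"
proof -
  have "is_partition 0" "part_length 0 \<le> N"
    by (auto simp: is_partition_def part_length_def antimono_def)
  from lookup_alternant_partition[OF this this(1)] show ?thesis
    by auto
qed

lemma is_partition_add_gt_weight:
  assumes G: "G \<in> gt_patterns \<mu>" and dom: "lr_dominant la \<mu> G"
  shows "is_partition (la + gt_weight \<mu> G)"
  using dom unfolding is_partition_def antimono_iff_le_Suc
  by (auto simp: lookup_add lookup_gt_weight[OF G] lr_dominant_def lr_violation_def not_less)

section \<open>Products of Schur functions\<close>

text \<open>
  Multiplied by \<open>a\<^sub>\<rho>\<close>, both sides become \<open>a\<^sub>\<lambda>\<^sub>+\<^sub>\<rho> S\<^sub>\<mu>\<close>.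
\<close>

lemma schur_poly_product:
  assumes la: "is_partition la" "part_length la \<le> N" and \<mu>: "is_partition \<mu>"
  shows "schur_poly N la * schur_poly N \<mu>
    = (\<Sum>G\<in>{G \<in> gt_patterns_upto N \<mu>. lr_dominant la \<mu> G}. schur_poly N (la + gt_weight \<mu> G))"
    (is "_ = sum _ ?A")
proof -
  let ?a = "alternant N (staircase N)"
  have "?a * schur_poly N (la + gt_weight \<mu> G) = alternant N (la + gt_weight \<mu> G + staircase N)"
    if "G \<in> ?A" for G
  proof (rule alternant_staircase_times_schur_poly)
    have G: "G \<in> gt_patterns \<mu>" and GN: "G \<in> gt_patterns_upto N \<mu>" and dom: "lr_dominant la \<mu> G"
      using that by (auto simp: gt_patterns_upto_def)
    show part: "is_partition (la + gt_weight \<mu> G)"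
      by (rule is_partition_add_gt_weight[OF G dom])
    show "part_length (la + gt_weight \<mu> G) \<le> N"
      using GN la lookup_partition_eq_0_iff[OF la(1), of N]
      unfolding gt_patterns_upto_iff_weight[OF G \<mu>] lookup_partition_eq_0_iff[OF part, symmetric]
      by (simp add: lookup_add)
  qed
  then have "?a * (\<Sum>G\<in>?A. schur_poly N (la + gt_weight \<mu> G)) = alternant N (la + staircase N) * schur_poly N \<mu>"
    unfolding sum_distrib_left alternant_times_schur_poly_dominant[OF la \<mu>] by (intro sum.cong) auto
  also have "\<dots> = ?a * (schur_poly N la * schur_poly N \<mu>)"
    by (simp add: alternant_staircase_times_schur_poly[OF la, symmetric] mult.assoc)
  finally show ?thesis
    using alternant_staircase_nonzero by simp
qed

lemma schur_eq_card_gt_patterns: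
  assumes "is_partition \<mu>"
  shows "schur \<mu> \<alpha> = int (card {G \<in> gt_patterns \<mu>. gt_weight \<mu> G = \<alpha>})"
  by (simp add: schur_def card_ssyt_weight[OF assms])

lemma keys_subset_lessThan_iff:
  fixes \<alpha> :: "nat \<Rightarrow>\<^sub>0 nat"
  shows "Poly_Mapping.keys \<alpha> \<subseteq> {..<N} \<longleftrightarrow> (\<forall>k\<ge>N. Poly_Mapping.lookup \<alpha> k = 0)"
proof (intro iffI allI impI subsetI)
  fix k assume "Poly_Mapping.keys \<alpha> \<subseteq> {..<N}" "N \<le> k"
  then have "k \<notin> Poly_Mapping.keys \<alpha>"
    by (meson lessThan_iff not_le subsetD)
  then show "Poly_Mapping.lookup \<alpha> k = 0"
    by (simp add: in_keys_iff)
next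
  fix k assume *: "\<forall>k\<ge>N. Poly_Mapping.lookup \<alpha> k = 0" and "k \<in> Poly_Mapping.keys \<alpha>"
  then have "\<not> N \<le> k"
    by (meson in_keys_iff)
  then show "k \<in> {..<N}"
    by simp
qed

lemma lookup_schur_poly:
  assumes \<mu>: "is_partition \<mu>"
  shows "Poly_Mapping.lookup (schur_poly N \<mu>) \<alpha> = (if Poly_Mapping.keys \<alpha> \<subseteq> {..<N} then schur \<mu> \<alpha> else 0)"
proof -
  have upto: "G \<in> gt_patterns_upto N \<mu> \<and> gt_weight \<mu> G = \<alpha>
    \<longleftrightarrow> G \<in> gt_patterns \<mu> \<and> gt_weight \<mu> G = \<alpha> \<and> Poly_Mapping.keys \<alpha> \<subseteq> {..<N}" for G
  proof (cases "G \<in> gt_patterns \<mu>")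
    case True
    then show ?thesis
      unfolding keys_subset_lessThan_iff gt_patterns_upto_iff_weight[OF True \<mu>] by auto
  qed (simp add: gt_patterns_upto_def)
  have "Poly_Mapping.lookup (schur_poly N \<mu>) \<alpha> = (\<Sum>G\<in>gt_patterns_upto N \<mu>. if gt_weight \<mu> G = \<alpha> then 1 else 0)"
    unfolding schur_poly_def lookup_sum lookup_single when_def by (intro sum.cong) auto
  also have "\<dots> = int (card {G \<in> gt_patterns_upto N \<mu>. gt_weight \<mu> G = \<alpha>})"
    using finite_gt_patterns_upto[OF \<mu>] by (subst sum.inter_filter[symmetric]) simp_all
  also have "{G \<in> gt_patterns_upto N \<mu>. gt_weight \<mu> G = \<alpha>}
    = (if Poly_Mapping.keys \<alpha> \<subseteq> {..<N} then {G \<in> gt_patterns \<mu>. gt_weight \<mu> G = \<alpha>} else {})"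
    unfolding upto by simp
  finally show ?thesis
    by (simp add: schur_eq_card_gt_patterns[OF \<mu>])
qed

lemma lookup_times:
  fixes p q :: "(nat \<Rightarrow>\<^sub>0 nat) \<Rightarrow>\<^sub>0 int"
  shows "Poly_Mapping.lookup (p * q) \<alpha>
    = mseries_mult (Poly_Mapping.lookup p) (Poly_Mapping.lookup q) \<alpha>"
proof -
  have "Poly_Mapping.lookup (p * q) \<alpha>
    = (\<Sum>(\<beta>, \<gamma>). Poly_Mapping.lookup p \<beta> * Poly_Mapping.lookup q \<gamma> when \<alpha> = \<beta> + \<gamma>)"
    unfolding times_poly_mapping.rep_eq by (rule prod_fun_unfold_prod) simp_all
  also have "\<dots> = (\<Sum>(\<beta>, \<gamma>)\<in>{(\<beta>, \<gamma>). \<beta> + \<gamma> = \<alpha>}.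
      Poly_Mapping.lookup p \<beta> * Poly_Mapping.lookup q \<gamma> when \<alpha> = \<beta> + \<gamma>)"
    by (rule Sum_any.expand_superset[OF finite_add_decompositions]) auto
  also have "\<dots> = mseries_mult (Poly_Mapping.lookup p) (Poly_Mapping.lookup q) \<alpha>"
    unfolding mseries_mult_def by (intro sum.cong) auto
  finally show ?thesis .
qed

lemma mseries_mult_schur:
  assumes la: "is_partition la" and \<mu>: "is_partition \<mu>" and keys: "Poly_Mapping.keys \<alpha> \<subseteq> {..<N}"
  shows "mseries_mult (schur la) (schur \<mu>) \<alpha> = Poly_Mapping.lookup (schur_poly N la * schur_poly N \<mu>) \<alpha>"
  unfolding lookup_times mseries_mult_def
proof (intro sum.cong refl, clarify)
  fix \<beta> \<gamma> assume eq: "\<alpha> = \<beta> + \<gamma>"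
  have "Poly_Mapping.keys \<beta> \<subseteq> {..<N}" "Poly_Mapping.keys \<gamma> \<subseteq> {..<N}"
    using keys by (auto simp: eq in_keys_iff lookup_add subset_iff)
  then show "schur la \<beta> * schur \<mu> \<gamma> = Poly_Mapping.lookup (schur_poly N la) \<beta> * Poly_Mapping.lookup (schur_poly N \<mu>) \<gamma>"
    by (simp add: lookup_schur_poly[OF la] lookup_schur_poly[OF \<mu>])
qed

lemma lookup_of_int_times:
  fixes p :: "(nat \<Rightarrow>\<^sub>0 nat) \<Rightarrow>\<^sub>0 int"
  shows "Poly_Mapping.lookup (of_int d * p) \<alpha> = d * Poly_Mapping.lookup p \<alpha>"
  by (induction d rule: int_induct[of _ 0]) (simp_all add: algebra_simps lookup_add lookup_minus)

text \<open>
  Multiplication by \<open>a\<^sub>\<rho>\<close> in sufficiently many variables turns a linear relation between Schur functions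
  into one between the alternants \<open>a\<^sub>\<nu>\<^sub>+\<^sub>\<rho>\<close>, and the exponent \<open>\<nu> + \<rho>\<close> occurs only in the alternant of \<open>\<nu>\<close>.
\<close>

lemma schur_expansion_unique:
  assumes c: "schur_expansion f c" and c': "schur_expansion f c'"
  shows "c = c'"
proof -
  define S where "S = {\<nu>. c \<nu> \<noteq> 0} \<union> {\<nu>. c' \<nu> \<noteq> 0}"
  have fin: "finite S" and part: "\<And>\<nu>. \<nu> \<in> S \<Longrightarrow> is_partition \<nu>"
    using c c' by (auto simp: S_def schur_expansion_def)
  have f: "f \<alpha> = (\<Sum>\<nu>\<in>S. b \<nu> * schur \<nu> \<alpha>)" if "schur_expansion f b" "{\<nu>. b \<nu> \<noteq> 0} \<subseteq> S" for b \<alpha>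
  proof -
    have "f \<alpha> = (\<Sum>\<nu>\<in>{\<nu>. b \<nu> \<noteq> 0}. b \<nu> * schur \<nu> \<alpha>)"
      using that(1) unfolding schur_expansion_def by metis
    also have "\<dots> = (\<Sum>\<nu>\<in>S. b \<nu> * schur \<nu> \<alpha>)"
      using that(2) fin by (intro sum.mono_neutral_left) auto
    finally show ?thesis .
  qed
  have diff0: "(\<Sum>\<nu>\<in>S. (c \<nu> - c' \<nu>) * schur \<nu> \<alpha>) = 0" for \<alpha>
    using f[OF c, of \<alpha>] f[OF c', of \<alpha>] by (simp add: S_def left_diff_distrib sum_subtractf)
  obtain N where N: "\<And>\<nu>. \<nu> \<in> S \<Longrightarrow> part_length \<nu> \<le> N"
    using finite_nat_set_iff_bounded_le[of "part_length ` S"] fin by auto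
  have "(\<Sum>\<nu>\<in>S. of_int (c \<nu> - c' \<nu>) * schur_poly N \<nu>) = 0"
  proof (rule poly_mapping_eqI)
    fix \<alpha>
    have "Poly_Mapping.lookup (\<Sum>\<nu>\<in>S. of_int (c \<nu> - c' \<nu>) * schur_poly N \<nu>) \<alpha>
      = (\<Sum>\<nu>\<in>S. (c \<nu> - c' \<nu>) * (if Poly_Mapping.keys \<alpha> \<subseteq> {..<N} then schur \<nu> \<alpha> else 0))"
      unfolding lookup_sum lookup_of_int_times
      by (intro sum.cong refl) (simp add: lookup_schur_poly part)
    also have "\<dots> = 0"
      using diff0 by (cases "Poly_Mapping.keys \<alpha> \<subseteq> {..<N}") simp_all
    finally show "Poly_Mapping.lookup (\<Sum>\<nu>\<in>S. of_int (c \<nu> - c' \<nu>) * schur_poly N \<nu>) \<alpha>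
      = Poly_Mapping.lookup 0 \<alpha>"
      by simp
  qed
  then have "0 = alternant N (staircase N) * (\<Sum>\<nu>\<in>S. of_int (c \<nu> - c' \<nu>) * schur_poly N \<nu>)"
    by simp
  also have "\<dots> = (\<Sum>\<nu>\<in>S. of_int (c \<nu> - c' \<nu>) * alternant N (\<nu> + staircase N))"
    unfolding sum_distrib_left
    by (intro sum.cong refl)
      (simp add: alternant_staircase_times_schur_poly[OF part N, symmetric] mult.left_commute)
  finally have zero: "(\<Sum>\<nu>\<in>S. of_int (c \<nu> - c' \<nu>) * alternant N (\<nu> + staircase N)) = 0"
    by simp
  show ?thesis
  proof
    fix \<nu>
    show "c \<nu> = c' \<nu>"
    proof (cases "\<nu> \<in> S")
      case True
      have "0 = (\<Sum>\<nu>'\<in>S. (c \<nu>' - c' \<nu>') * Poly_Mapping.lookup (alternant N (\<nu>' + staircase N)) (\<nu> + staircase N))"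
        using arg_cong[OF zero, of "\<lambda>p. Poly_Mapping.lookup p (\<nu> + staircase N)"]
        unfolding lookup_sum lookup_of_int_times by simp
      also have "\<dots> = (\<Sum>\<nu>'\<in>S. if \<nu>' = \<nu> then c \<nu>' - c' \<nu>' else 0)"
        by (intro sum.cong refl) (simp add: lookup_alternant_partition[OF part[OF True] N[OF True] part])
      also have "\<dots> = c \<nu> - c' \<nu>"
        using True fin by simp
      finally show ?thesis
        by simp
    next
      case False
      then show ?thesis
        by (simp add: S_def)
    qed
  qed
qed

section \<open>The Littlewood-Richardson rule\<close>

definition lr_patterns :: "(nat \<Rightarrow>\<^sub>0 nat) \<Rightarrow> (nat \<Rightarrow>\<^sub>0 nat) \<Rightarrow> (nat \<Rightarrow> nat \<Rightarrow> nat) set" where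
  "lr_patterns la \<mu> = {G \<in> gt_patterns \<mu>. lr_dominant la \<mu> G}"

text \<open>
  The number of variables has to be fixed independently of the pattern.  A bound exists because
  \<open>\<lambda> + wt(G)\<close> is a partition of \<open>|\<lambda>| + |\<mu>|\<close>, and so has at most that many parts.
\<close>

lemma lr_patterns_bounded_entries:
  assumes la: "is_partition la" and \<mu>: "is_partition \<mu>"
  shows "\<exists>N. lr_patterns la \<mu> \<subseteq> gt_patterns_upto N \<mu>"
proof (intro exI)
  let ?L = "\<Sum>i<part_length la. Poly_Mapping.lookup la i" and ?M = "\<Sum>i<part_length \<mu>. Poly_Mapping.lookup \<mu> i"
  show "lr_patterns la \<mu> \<subseteq> gt_patterns_upto (?L + ?M) \<mu>"
  proof
    fix G assume "G \<in> lr_patterns la \<mu>"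
    then have G: "G \<in> gt_patterns \<mu>" and dom: "lr_dominant la \<mu> G"
      by (auto simp: lr_patterns_def)
    have weights: "(\<Sum>k<m. column_weight \<mu> G 0 k) = (\<Sum>i<part_length \<mu>. G m i)" for m
    proof (induction m)
      case (Suc m)
      then show ?case
        using column_weight_eq_diff[OF G, of m 0] by simp
    qed (simp add: gt_level_0[OF G])
    have "Poly_Mapping.lookup (gt_weight \<mu> G) k = 0" if k: "k \<ge> ?L + ?M" for k
    proof (rule ccontr)
      assume "Poly_Mapping.lookup (gt_weight \<mu> G) k \<noteq> 0"
      then have "1 \<le> Poly_Mapping.lookup (la + gt_weight \<mu> G) k"
        by (simp add: lookup_add)
      moreover have "Poly_Mapping.lookup (la + gt_weight \<mu> G) k \<le> Poly_Mapping.lookup (la + gt_weight \<mu> G) i"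
        if "i \<le> k" for i
        using is_partition_add_gt_weight[OF G dom] that unfolding is_partition_def by (rule antimonoD)
      ultimately have pos: "1 \<le> Poly_Mapping.lookup (la + gt_weight \<mu> G) i" if "i \<le> k" for i
        using that by (meson le_trans)
      have "Suc k = (\<Sum>i<Suc k. 1)"
        by simp
      also have "\<dots> \<le> (\<Sum>i<Suc k. Poly_Mapping.lookup (la + gt_weight \<mu> G) i)"
        by (intro sum_mono pos) simp
      also have "\<dots> = (\<Sum>i<Suc k. Poly_Mapping.lookup la i) + (\<Sum>i<part_length \<mu>. G (Suc k) i)"
        unfolding weights[symmetric] by (simp only: lookup_add lookup_gt_weight[OF G] sum.distrib)
      also have "\<dots> \<le> ?L + ?M"
      proof (intro add_mono sum_mono gt_le_shape[OF G])
        have "(\<Sum>i<Suc k. Poly_Mapping.lookup la i) \<le> (\<Sum>i<max (Suc k) (part_length la). Poly_Mapping.lookup la i)"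
          by (intro sum_mono2) auto
        also have "\<dots> = ?L"
          by (intro sum.mono_neutral_right) (auto simp: lookup_partition_eq_0_iff[OF la])
        finally show "(\<Sum>i<Suc k. Poly_Mapping.lookup la i) \<le> ?L" .
      qed
      finally show False
        using k by simp
    qed
    then show "G \<in> gt_patterns_upto (?L + ?M) \<mu>"
      by (simp add: gt_patterns_upto_iff_weight[OF G \<mu>])
  qed
qed

theorem schur_expansion_product:
  assumes la: "is_partition la" and \<mu>: "is_partition \<mu>"
  shows "schur_expansion (mseries_mult (schur la) (schur \<mu>))
    (\<lambda>\<nu>. int (card {G \<in> lr_patterns la \<mu>. la + gt_weight \<mu> G = \<nu>}))" (is "schur_expansion _ ?c")
proof -
  obtain N\<^sub>0 where N\<^sub>0: "lr_patterns la \<mu> \<subseteq> gt_patterns_upto N\<^sub>0 \<mu>"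
    using lr_patterns_bounded_entries[OF la \<mu>] by blast
  have fin: "finite (lr_patterns la \<mu>)"
    using N\<^sub>0 finite_gt_patterns_upto[OF \<mu>] by (rule finite_subset)
  let ?S = "{\<nu>. ?c \<nu> \<noteq> 0}"
  have S: "?S = (\<lambda>G. la + gt_weight \<mu> G) ` lr_patterns la \<mu>"
    using fin by (auto simp: card_eq_0_iff)
  then have finS: "finite ?S"
    using fin by simp
  have part: "is_partition \<nu>" if "\<nu> \<in> ?S" for \<nu>
    using that unfolding S by (auto simp: lr_patterns_def is_partition_add_gt_weight)
  have "mseries_mult (schur la) (schur \<mu>) \<alpha> = (\<Sum>\<nu>\<in>?S. ?c \<nu> * schur \<nu> \<alpha>)" for \<alpha>
  proof -
    obtain n where n: "Poly_Mapping.keys \<alpha> \<subseteq> {..<n}"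
      using finite_nat_set_iff_bounded[of "Poly_Mapping.keys \<alpha>"] by auto
    define N where "N = max N\<^sub>0 (max n (part_length la))"
    have keys: "Poly_Mapping.keys \<alpha> \<subseteq> {..<N}" and len: "part_length la \<le> N"
      using n by (auto simp: N_def)
    have patterns: "{G \<in> gt_patterns_upto N \<mu>. lr_dominant la \<mu> G} = lr_patterns la \<mu>"
      using N\<^sub>0 by (auto simp: N_def lr_patterns_def gt_patterns_upto_def)
    have "mseries_mult (schur la) (schur \<mu>) \<alpha>
      = (\<Sum>G\<in>lr_patterns la \<mu>. Poly_Mapping.lookup (schur_poly N (la + gt_weight \<mu> G)) \<alpha>)"
      unfolding mseries_mult_schur[OF la \<mu> keys] schur_poly_product[OF la len \<mu>] patterns lookup_sum ..
    also have "\<dots> = (\<Sum>G\<in>lr_patterns la \<mu>. schur (la + gt_weight \<mu> G) \<alpha>)"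
      using keys by (intro sum.cong refl)
        (simp add: lookup_schur_poly lr_patterns_def is_partition_add_gt_weight)
    also have "\<dots> = (\<Sum>\<nu>\<in>?S. \<Sum>G\<in>{G \<in> lr_patterns la \<mu>. la + gt_weight \<mu> G = \<nu>}. schur (la + gt_weight \<mu> G) \<alpha>)"
      by (rule sum.group[symmetric, OF fin finS]) (simp only: S order_refl)
    also have "\<dots> = (\<Sum>\<nu>\<in>?S. ?c \<nu> * schur \<nu> \<alpha>)"
      by (intro sum.cong refl) simp
    finally show ?thesis .
  qed
  then show ?thesis
    unfolding schur_expansion_def using finS part by blast
qed

theorem lr_coeff_eq_card_lr_patterns:
  assumes "is_partition la" "is_partition \<mu>"
  shows "lr_coeff la \<mu> \<nu> = int (card {G \<in> lr_patterns la \<mu>. la + gt_weight \<mu> G = \<nu>})"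
proof -
  note expansion = schur_expansion_product[OF assms]
  have "(THE c. schur_expansion (mseries_mult (schur la) (schur \<mu>)) c)
    = (\<lambda>\<nu>. int (card {G \<in> lr_patterns la \<mu>. la + gt_weight \<mu> G = \<nu>}))"
    using expansion schur_expansion_unique[OF _ expansion] by (rule the_equality)
  then show ?thesis
    by (simp add: lr_coeff_def)
qed

section \<open>Comparison with Kostka numbers\<close>

text \<open>
  Otherwise the rows \<open>k\<close> and \<open>k + 1\<close> of \<open>\<nu>/\<lambda>\<close> would share the column \<open>\<lambda>\<^sub>k\<close>.
\<close>

lemma horizontal_strip_interlaces:
  assumes "is_partition la" "is_partition \<nu>" and strip: "horizontal_strip \<nu> la"
  shows "Poly_Mapping.lookup \<nu> (Suc k) \<le> Poly_Mapping.lookup la k"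
proof (rule ccontr)
  let ?c = "Poly_Mapping.lookup la k"
  assume "\<not> ?thesis"
  moreover have "Poly_Mapping.lookup la (Suc k) \<le> ?c"
    using assms(1) by (simp add: is_partition_def antimonoD)
  moreover have "Poly_Mapping.lookup \<nu> (Suc k) \<le> Poly_Mapping.lookup \<nu> k"
    using assms(2) by (simp add: is_partition_def antimonoD)
  ultimately have "(k, ?c) \<in> diagram \<nu> - diagram la" "(Suc k, ?c) \<in> diagram \<nu> - diagram la"
    by (auto simp: diagram_def)
  then have "(k, ?c) = (Suc k, ?c)"
    using strip unfolding horizontal_strip_def by (intro inj_onD[of snd "diagram \<nu> - diagram la"]) auto
  then show False
    by simp
qed

lemma lr_dominant_horizontal_strip:
  assumes "is_partition la" "is_partition \<nu>" "horizontal_strip \<nu> la"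
    and G: "G \<in> gt_patterns \<mu>" and eq: "la + gt_weight \<mu> G = \<nu>"
  shows "lr_dominant la \<mu> G"
  unfolding lr_dominant_def lr_violation_def not_less
proof (intro allI)
  fix j k
  have "Poly_Mapping.lookup la (Suc k) + column_weight \<mu> G j (Suc k)
    \<le> Poly_Mapping.lookup la (Suc k) + column_weight \<mu> G 0 (Suc k)"
    by (intro add_left_mono column_weight_le)
  also have "\<dots> = Poly_Mapping.lookup \<nu> (Suc k)"
    by (simp add: eq[symmetric] lookup_add lookup_gt_weight[OF G])
  also have "\<dots> \<le> Poly_Mapping.lookup la k"
    by (rule horizontal_strip_interlaces[OF assms(1-3)])
  finally show "Poly_Mapping.lookup la (Suc k) + column_weight \<mu> G j (Suc k)
    \<le> Poly_Mapping.lookup la k + column_weight \<mu> G j k"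
    by simp
qed

theorem proposition1p2:
  fixes n :: nat and la \<mu> \<nu> \<chi> :: "nat \<Rightarrow>\<^sub>0 nat"
  assumes "is_partition la" and "part_length la \<le> n"
    and "is_partition \<mu>" and "part_length \<mu> \<le> n"
    and "is_partition \<nu>" and "part_length \<nu> \<le> n"
    and "\<forall>i<n. Poly_Mapping.lookup la i \<le> Poly_Mapping.lookup \<nu> i"
    and "\<forall>i<n. Poly_Mapping.lookup \<chi> i = Poly_Mapping.lookup \<nu> i - Poly_Mapping.lookup la i"
    and "\<forall>i\<ge>n. Poly_Mapping.lookup \<chi> i = 0"
    and "(\<Sum>i<n. Poly_Mapping.lookup \<chi> i) = part_size \<mu>"
  shows "lr_coeff la \<mu> \<nu> \<le> int (kostka \<mu> \<chi>) \<and>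
         (horizontal_strip \<nu> la \<longrightarrow> lr_coeff la \<mu> \<nu> = int (kostka \<mu> \<chi>))"
proof -
  have "Poly_Mapping.lookup \<nu> i = Poly_Mapping.lookup (la + \<chi>) i" for i
    using assms(2,6-9) lookup_partition_eq_0_iff[OF assms(1), of i] lookup_partition_eq_0_iff[OF assms(5), of i]
    by (cases "i < n") (simp_all add: lookup_add)
  then have \<nu>: "\<nu> = la + \<chi>"
    by (rule poly_mapping_eqI)
  have lr: "lr_coeff la \<mu> \<nu> = int (card {G \<in> lr_patterns la \<mu>. gt_weight \<mu> G = \<chi>})"
    by (simp add: lr_coeff_eq_card_lr_patterns[OF assms(1,3)] \<nu>)
  have kostka: "kostka \<mu> \<chi> = card {G \<in> gt_patterns \<mu>. gt_weight \<mu> G = \<chi>}"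
    by (simp add: kostka_def card_ssyt_weight[OF assms(3)])
  have "card {G \<in> lr_patterns la \<mu>. gt_weight \<mu> G = \<chi>} \<le> card {G \<in> gt_patterns \<mu>. gt_weight \<mu> G = \<chi>}"
    by (intro card_mono finite_gt_patterns_weight[OF assms(3)]) (auto simp: lr_patterns_def)
  moreover have "{G \<in> lr_patterns la \<mu>. gt_weight \<mu> G = \<chi>} = {G \<in> gt_patterns \<mu>. gt_weight \<mu> G = \<chi>}"
    if "horizontal_strip \<nu> la"
    using lr_dominant_horizontal_strip[OF assms(1,5) that] by (auto simp: lr_patterns_def \<nu>)
  ultimately show ?thesis
    by (simp add: lr kostka)
qed

end
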